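(* Let $A\in\mathbb{C}^{N\times N}$ be Hermitian positive definite, let $\mathbf b\in\mathbb{C}^N$, and let $f(z)=\int_{t_0}^{+\infty}(z+t)^{-1}\,\mathrm{d}\mu(t)$ be a Stieltjes function, where $t_0\ge 0$. Let $m\ge 1$, $k \geq 0$ be integers, let $V_m\in\mathbb{C}^{N\times m}$ be a matrix whose columns span the Krylov space $\mathcal{K}_m(A,\mathbf b)=\operatorname{span}\{\mathbf b,A\mathbf b,\ldots,A^{m-1}\mathbf b\}$, let $U\in\mathbb{C}^{N\times k}$ be a matrix (whose columns span an arbitrary augmentation space), and suppose that the columns of $\mathbf V_m:=[V_m,U]\in\mathbb{C}^{N\times(m+k)}$ are linearly independent. Let $$\mathbf f_m:=\mathbf V_m\, f\!\left(\mathbf V_m^\dagger A\mathbf V_m\right)\mathbf V_m^\dagger \mathbf b$$ be the augmented FOM approximant of $f(A)\mathbf b$. Let $\lambda_{\min}$ and $\lambda_{\max}$ denote the smallest and largest eigenvalues of $A$, respectively, and define $$\kappa(t):=\frac{\lambda_{\max}+t}{\lambda_{\min}+t},\qquad c(t):=\frac{\sqrt{\kappa(t)}-1}{\sqrt{\kappa(t)}+1},\qquad \alpha_m(t):=\frac{1}{\cosh(m\ln c(t))}.$$ Then $$\|f(A)\mathbf b-\mathbf f_m\|_A\le C\,\alpha_m(t_0),\qquad\text{where } C=\|\mathbf b\|_2\,\sqrt{\lambda_{\max}}\cdot f\!\left(\sqrt{\lambda_{\min}\lambda_{\max}}\right).$$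
   Context: $\|\mathbf v\|_A:=\sqrt{\mathbf v^*A\mathbf v}$ is the energy norm induced by the Hermitian positive definite matrix $A$, and $\|\cdot\|_2$ is the Euclidean norm. $\mathbf V_m^\dagger=(\mathbf V_m^*\mathbf V_m)^{-1}\mathbf V_m^*$ is the Moore–Penrose pseudoinverse of the full-column-rank matrix $\mathbf V_m$ (its columns need not be orthonormal). A Stieltjes function here is a function of the form $f(z)=\int_{t_0}^{+\infty}(z+t)^{-1}\,\mathrm{d}\mu(t)$ with $\mu$ a nonnegative Borel measure on $[t_0,+\infty)$ such that the integral converges (absolutely) for $z>0$. For a square matrix $B$ whose eigenvalues are all positive, $f(B)$ denotes the usual matrix function, $f(B)=\int_{t_0}^{+\infty}(B+tI)^{-1}\,\mathrm{d}\mu(t)$; the matrix $\mathbf V_m^\dagger A\mathbf V_m$ is similar to a Hermitian positive definite matrix, so $f(\mathbf V_m^\dagger A\mathbf V_m)$ is defined. In the degenerate case $\lambda_{\min}=\lambda_{\max}$, where $c(t)=0$, the value $\alpha_m(t)$ is understood as its limit $0$. *)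

theory Defs
  imports
    "HOL-Analysis.Analysis"
    "Jordan_Normal_Form.Schur_Decomposition"
    "Jordan_Normal_Form.VS_Connect"
    "Jordan_Normal_Form.Gauss_Jordan_Elimination"
begin

unbundle no inner_syntax
unbundle no vec_syntax

text \<open>Matrices and vectors are those of Jordan_Normal_Form, whose dimensions are natural numbers.
  This allows an \<open>N \<times> k\<close> augmentation block with \<open>k = 0\<close>.\<close>

definition hermitian_pos_def :: "complex mat \<Rightarrow> bool" where
  "hermitian_pos_def A \<longleftrightarrow> square_mat A \<and> mat_adjoint A = A \<and>
     (\<forall>v \<in> carrier_vec (dim_row A). v \<noteq> 0\<^sub>v (dim_row A) \<longrightarrow> 0 < Re (conjugate v \<bullet> (A *\<^sub>v v)))"

definition energy_norm :: "complex mat \<Rightarrow> complex vec \<Rightarrow> real" where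
  "energy_norm A v = sqrt (Re (conjugate v \<bullet> (A *\<^sub>v v)))"

definition euclidean_norm :: "complex vec \<Rightarrow> real" where
  "euclidean_norm v = sqrt (\<Sum>i<dim_vec v. (cmod (v $ i))\<^sup>2)"

text \<open>The eigenvalues of a Hermitian matrix are real, so no eigenvalue is lost by letting \<open>x\<close> range
  over the reals.\<close>

definition lambda_min :: "complex mat \<Rightarrow> real" where
  "lambda_min A = Min {x. eigenvalue A (complex_of_real x)}"

definition lambda_max :: "complex mat \<Rightarrow> real" where
  "lambda_max A = Max {x. eigenvalue A (complex_of_real x)}"

definition cspan :: "nat \<Rightarrow> complex vec set \<Rightarrow> complex vec set" where
  "cspan N S = LinearCombinations.module.span class_ring (module_vec TYPE(complex) N) S"

text \<open>Linear independence of the columns as a family: repeated columns count as dependent.\<close>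

definition lin_indpt_cols :: "complex mat \<Rightarrow> bool" where
  "lin_indpt_cols V \<longleftrightarrow> distinct (cols V) \<and>
     \<not> LinearCombinations.module.lin_dep class_ring (module_vec TYPE(complex) (dim_row V))
         (set (cols V))"

definition krylov_space :: "complex mat \<Rightarrow> complex vec \<Rightarrow> nat \<Rightarrow> complex vec set" where
  "krylov_space A b m = cspan (dim_row A) {(A ^\<^sub>m j) *\<^sub>v b | j. j < m}"

definition append_cols :: "complex mat \<Rightarrow> complex mat \<Rightarrow> complex mat" where
  "append_cols V U = mat_of_cols (dim_row V) (cols V @ cols U)"

text \<open>Only meaningful for invertible matrices.\<close>

definition mat_inv :: "complex mat \<Rightarrow> complex mat" where
  "mat_inv B = the (mat_inverse B)"

text \<open>The Moore--Penrose inverse of a matrix of full column rank.\<close>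

definition pseudo_inverse :: "complex mat \<Rightarrow> complex mat" where
  "pseudo_inverse V = mat_inv (mat_adjoint V * V) * mat_adjoint V"

text \<open>The carrier of the measure \<open>\<mu>\<close> is the half-line \<open>[t0, \<infinity>)\<close> itself, so integrals with respect
  to \<open>\<mu>\<close> are integrals over that half-line.\<close>

definition stieltjes_measure :: "real \<Rightarrow> real measure \<Rightarrow> bool" where
  "stieltjes_measure t0 \<mu> \<longleftrightarrow> sets \<mu> = sets (restrict_space borel {t0..}) \<and>
     (\<forall>z>0. integrable \<mu> (\<lambda>t. 1 / (z + t)))"

definition stieltjes_fun :: "real measure \<Rightarrow> real \<Rightarrow> real" where
  "stieltjes_fun \<mu> z = (LINT t|\<mu>. 1 / (z + t))"

text \<open>The matrix-valued integral of \<open>(B + t I)\<^sup>-\<^sup>1\<close>, taken entrywise.\<close>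

definition stieltjes_mat_fun :: "real measure \<Rightarrow> complex mat \<Rightarrow> complex mat" where
  "stieltjes_mat_fun \<mu> B = mat (dim_row B) (dim_row B) (\<lambda>(i, j).
     LINT t|\<mu>. mat_inv (B + complex_of_real t \<cdot>\<^sub>m 1\<^sub>m (dim_row B)) $$ (i, j))"

definition fom_approx ::
    "real measure \<Rightarrow> complex mat \<Rightarrow> complex vec \<Rightarrow> complex mat \<Rightarrow> complex vec" where
  "fom_approx \<mu> A b V =
     V *\<^sub>v (stieltjes_mat_fun \<mu> (pseudo_inverse V * A * V) *\<^sub>v (pseudo_inverse V *\<^sub>v b))"

definition kappa :: "complex mat \<Rightarrow> real \<Rightarrow> real" where
  "kappa A t = (lambda_max A + t) / (lambda_min A + t)"

definition c_fun :: "complex mat \<Rightarrow> real \<Rightarrow> real" where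
  "c_fun A t = (sqrt (kappa A t) - 1) / (sqrt (kappa A t) + 1)"

text \<open>For \<open>c(t) = 0\<close> the value is the limit \<open>0\<close>; the formula itself would give \<open>1\<close> there, since
  \<open>ln 0 = 0\<close> in HOL.\<close>

definition alpha :: "complex mat \<Rightarrow> nat \<Rightarrow> real \<Rightarrow> real" where
  "alpha A m t = (if c_fun A t = 0 then 0 else 1 / cosh (real m * ln (c_fun A t)))"

end

theory Submission
  imports Defs "Jordan_Normal_Form.DL_Rank"
begin

text \<open>
  Write \<open>B = V\<^sup>\<dagger>AV\<close>. Both \<open>f(A)b\<close> and the approximant are integrals of resolvents, so their difference
  is \<open>\<integral> e\<^sub>t d\<mu>(t)\<close> with \<open>e\<^sub>t = (A + tI)\<^sup>-\<^sup>1b - V(B + tI)\<^sup>-\<^sup>1V\<^sup>\<dagger>b\<close>, and it suffices to bound the energy norm of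
  each \<open>e\<^sub>t\<close> and to integrate (\<open>energy_norm_integral_le\<close>).

  Multiplying \<open>(B + tI)z = V\<^sup>\<dagger>b\<close> by \<open>V\<^sup>*V\<close> turns it into \<open>V\<^sup>*(A + tI)Vz = V\<^sup>*b\<close>: the vector \<open>Vz\<close> is
  the Galerkin solution of \<open>(A + tI)x = b\<close> on the range of \<open>V\<close>, hence optimal there in the norm of
  \<open>A + tI\<close> (\<open>galerkin_optimal\<close>). The range contains the Krylov space, so the error
  is at most the one of the best polynomial \<open>w = r(A)b\<close> with \<open>degree r < m\<close>. In an eigenbasis the
  component of \<open>x - w\<close> at the eigenvalue \<open>e\<close> is the one of \<open>b\<close> times
  \<open>(1 - (e + t) r(e)) / (e + t)\<close>. The scaled Chebyshev polynomial makes the numerator at most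
  \<open>\<alpha>\<^sub>m(t)\<close> on \<open>[\<lambda>\<^sub>m\<^sub>i\<^sub>n, \<lambda>\<^sub>m\<^sub>a\<^sub>x]\<close> (\<open>residual_poly_exists\<close>), which gives the
  conjugate gradient bound \<open>\<alpha>\<^sub>m(t) \<parallel>b\<parallel> / sqrt (\<lambda>\<^sub>m\<^sub>i\<^sub>n + t)\<close> for \<open>e\<^sub>t\<close> in the norm of \<open>A + tI\<close>
  (\<open>krylov_polynomial_residual\<close>).

  Passing to the norm of \<open>A\<close> gains the factor \<open>sqrt (\<lambda>\<^sub>m\<^sub>a\<^sub>x / (\<lambda>\<^sub>m\<^sub>a\<^sub>x + t))\<close>, and
  \<open>(\<lambda>\<^sub>m\<^sub>a\<^sub>x + t)(\<lambda>\<^sub>m\<^sub>i\<^sub>n + t) \<ge> (sqrt (\<lambda>\<^sub>m\<^sub>i\<^sub>n \<lambda>\<^sub>m\<^sub>a\<^sub>x) + t)\<^sup>2\<close> by the inequality of the arithmetic and geometric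
  means (\<open>shifted_fom_error\<close>). Since \<open>\<alpha>\<^sub>m\<close> is decreasing in \<open>t\<close>, it can be replaced by \<open>\<alpha>\<^sub>m(t\<^sub>0)\<close>, and
  what remains under the integral is the Stieltjes function at \<open>sqrt (\<lambda>\<^sub>m\<^sub>i\<^sub>n \<lambda>\<^sub>m\<^sub>a\<^sub>x)\<close>.

  The entrywise integrals defining \<open>f(A)\<close> and \<open>f(B)\<close> need a spectral theorem for both matrices.
  \<open>B\<close> is not Hermitian, but it is self-adjoint for the inner product given by \<open>V\<^sup>*V\<close>. The spectral
  theorem is therefore proved for an arbitrary Hermitian positive definite form
  (\<open>eigen_split_exists\<close>) and used with the forms \<open>I\<close> and \<open>V\<^sup>*V\<close>.
\<close>

section \<open>Hermitian forms and entrywise sums of vectors\<close>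

definition hform :: "complex mat \<Rightarrow> complex vec \<Rightarrow> complex vec \<Rightarrow> complex" where
  "hform G u v = conjugate u \<bullet> (G *\<^sub>v v)"

text \<open>Vectors of a dimension that is not part of the type form no additive monoid type. Summing them
  entrywise reduces every manipulation to sums of complex numbers.\<close>

definition vsum :: "nat \<Rightarrow> ('a \<Rightarrow> complex vec) \<Rightarrow> 'a set \<Rightarrow> complex vec" where
  "vsum n g S = vec n (\<lambda>i. \<Sum>e\<in>S. g e $ i)"

lemma dim_mat_adjoint [simp]:
  "dim_row (mat_adjoint M) = dim_col M" "dim_col (mat_adjoint M) = dim_row M"
  by (auto simp: mat_adjoint_def)

lemma mat_adjoint_carrier [simp]:
  "M \<in> carrier_mat n k \<Longrightarrow> mat_adjoint M \<in> carrier_mat k n"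
  by (metis carrier_matD carrier_matI dim_mat_adjoint)

lemma index_mat_adjoint:
  "i < dim_col M \<Longrightarrow> j < dim_row M \<Longrightarrow> mat_adjoint M $$ (i, j) = cnj (M $$ (j, i))"
  by (simp add: mat_adjoint_def mat_of_rows_index)

lemma sprod_mult_mat_vec_adjoint:
  fixes M :: "complex mat"
  assumes "M \<in> carrier_mat n k" "u \<in> carrier_vec n" "v \<in> carrier_vec k"
  shows "conjugate u \<bullet> (M *\<^sub>v v) = conjugate (mat_adjoint M *\<^sub>v u) \<bullet> v"
proof -
  have "conjugate u \<bullet> (M *\<^sub>v v) = (\<Sum>i<n. \<Sum>j<k. cnj (u $ i) * M $$ (i, j) * v $ j)"
    using assms by (simp add: scalar_prod_def sum_distrib_left atLeast0LessThan mult.assoc)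
  also have "\<dots> = (\<Sum>j<k. \<Sum>i<n. cnj (u $ i) * M $$ (i, j) * v $ j)"
    by (rule sum.swap)
  also have "\<dots> = conjugate (mat_adjoint M *\<^sub>v u) \<bullet> v"
    using assms
    by (simp add: scalar_prod_def sum_distrib_left atLeast0LessThan index_mat_adjoint mult_ac)
  finally show ?thesis .
qed

lemma mat_adjoint_mult:
  fixes M L :: "complex mat"
  assumes "M \<in> carrier_mat n k" "L \<in> carrier_mat k l"
  shows "mat_adjoint (M * L) = mat_adjoint L * mat_adjoint M"
  using assms
  by (intro eq_matI) (auto simp: index_mat_adjoint scalar_prod_def mult.commute)

lemma mat_adjoint_adjoint [simp]: "mat_adjoint (mat_adjoint M) = (M :: complex mat)"
  by (intro eq_matI) (auto simp: index_mat_adjoint)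

lemma hform_add_right:
  assumes "G \<in> carrier_mat n n" "u \<in> carrier_vec n" "v \<in> carrier_vec n" "w \<in> carrier_vec n"
  shows "hform G u (v + w) = hform G u v + hform G u w"
  using assms unfolding hform_def
  by (subst mult_add_distrib_mat_vec[of _ n n]) (auto intro!: scalar_prod_add_distrib[of _ n])

lemma hform_smult_right:
  assumes "G \<in> carrier_mat n n" "u \<in> carrier_vec n" "v \<in> carrier_vec n"
  shows "hform G u (c \<cdot>\<^sub>v v) = c * hform G u v"
  using assms unfolding hform_def
  by (simp add: mult_mat_vec[of _ n n] scalar_prod_smult_right)

lemma hform_swap:
  assumes "G \<in> carrier_mat n n" "mat_adjoint G = G" "u \<in> carrier_vec n" "v \<in> carrier_vec n"
  shows "hform G u v = cnj (hform G v u)"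
proof -
  have "hform G u v = conjugate (G *\<^sub>v u) \<bullet> v"
    using sprod_mult_mat_vec_adjoint[of G n n u v] assms by (simp add: hform_def)
  also have "\<dots> = cnj (conjugate v \<bullet> (G *\<^sub>v u))"
    using assms by (simp add: scalar_prod_def mult.commute)
  finally show ?thesis by (simp add: hform_def)
qed

lemma hform_add_left:
  assumes "G \<in> carrier_mat n n" "u \<in> carrier_vec n" "v \<in> carrier_vec n" "w \<in> carrier_vec n"
  shows "hform G (v + w) u = hform G v u + hform G w u"
  using assms unfolding hform_def
  by (subst conjugate_add_vec[of _ n]) (auto intro!: add_scalar_prod_distrib[of _ n])

lemma hform_smult_left:
  assumes "G \<in> carrier_mat n n" "u \<in> carrier_vec n" "v \<in> carrier_vec n"
  shows "hform G (c \<cdot>\<^sub>v v) u = cnj c * hform G v u"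
  using assms unfolding hform_def
  by (simp add: conjugate_smult_vec)

lemma vsum_carrier [simp]: "vsum n g S \<in> carrier_vec n"
  and dim_vsum [simp]: "dim_vec (vsum n g S) = n"
  and index_vsum: "i < n \<Longrightarrow> vsum n g S $ i = (\<Sum>e\<in>S. g e $ i)"
  by (auto simp: vsum_def)

lemma vsum_cong: "(\<And>e. e \<in> S \<Longrightarrow> g e = h e) \<Longrightarrow> vsum n g S = vsum n h S"
  by (simp add: vsum_def)

lemma mult_mat_vec_vsum:
  assumes "M \<in> carrier_mat k n" "\<And>e. e \<in> S \<Longrightarrow> g e \<in> carrier_vec n"
  shows "M *\<^sub>v vsum n g S = vsum k (\<lambda>e. M *\<^sub>v g e) S"
proof (intro eq_vecI)
  fix i assume "i < dim_vec (vsum k (\<lambda>e. M *\<^sub>v g e) S)"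
  then have i: "i < k" by simp
  have "(M *\<^sub>v vsum n g S) $ i = (\<Sum>j<n. \<Sum>e\<in>S. M $$ (i, j) * g e $ j)"
    using assms i by (simp add: scalar_prod_def index_vsum sum_distrib_left atLeast0LessThan)
  also have "\<dots> = (\<Sum>e\<in>S. \<Sum>j<n. M $$ (i, j) * g e $ j)"
    by (rule sum.swap)
  also have "\<dots> = (\<Sum>e\<in>S. (M *\<^sub>v g e) $ i)"
    using assms i by (intro sum.cong) (simp_all add: scalar_prod_def atLeast0LessThan carrier_vecD[OF assms(2)])
  finally show "(M *\<^sub>v vsum n g S) $ i = vsum k (\<lambda>e. M *\<^sub>v g e) S $ i"
    using i by (simp add: index_vsum)
qed (use assms in auto)

lemma hform_vsum_right:
  assumes "G \<in> carrier_mat n n" "u \<in> carrier_vec n" "\<And>e. e \<in> S \<Longrightarrow> g e \<in> carrier_vec n"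
  shows "hform G u (vsum n g S) = (\<Sum>e\<in>S. hform G u (g e))"
proof -
  have "hform G u (vsum n g S) = (\<Sum>j<n. \<Sum>e\<in>S. cnj (u $ j) * (G *\<^sub>v g e) $ j)"
    using assms
    by (simp add: hform_def mult_mat_vec_vsum[of _ n] scalar_prod_def[of _ "vsum _ _ _"] index_vsum
        sum_distrib_left atLeast0LessThan)
  also have "\<dots> = (\<Sum>e\<in>S. \<Sum>j<n. cnj (u $ j) * (G *\<^sub>v g e) $ j)"
    by (rule sum.swap)
  also have "\<dots> = (\<Sum>e\<in>S. hform G u (g e))"
    unfolding hform_def scalar_prod_def
    using assms(1,2)
    by (intro sum.cong) (simp_all add: atLeast0LessThan carrier_vecD[OF assms(3)])
  finally show ?thesis .
qed

lemma hform_vsum_left: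
  assumes "G \<in> carrier_mat n n" "u \<in> carrier_vec n" "\<And>e. e \<in> S \<Longrightarrow> g e \<in> carrier_vec n"
  shows "hform G (vsum n g S) u = (\<Sum>e\<in>S. hform G (g e) u)"
proof -
  have "hform G (vsum n g S) u = (\<Sum>j<n. \<Sum>e\<in>S. cnj (g e $ j) * (G *\<^sub>v u) $ j)"
    using assms
    by (simp add: hform_def scalar_prod_def[of "conjugate _" "_ *\<^sub>v _"] index_vsum
        sum_distrib_right atLeast0LessThan)
  also have "\<dots> = (\<Sum>e\<in>S. \<Sum>j<n. cnj (g e $ j) * (G *\<^sub>v u) $ j)"
    by (rule sum.swap)
  also have "\<dots> = (\<Sum>e\<in>S. hform G (g e) u)"
    unfolding hform_def scalar_prod_def
    using assms(1,2)
    by (intro sum.cong) (simp_all add: atLeast0LessThan carrier_vecD[OF assms(3)])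
  finally show ?thesis .
qed

text \<open>Parseval's identity for a family that is orthogonal but not normalised; zero vectors may occur.\<close>

lemma hform_vsum_orthogonal:
  assumes "G \<in> carrier_mat n n" "finite S" "\<And>e. e \<in> S \<Longrightarrow> g e \<in> carrier_vec n"
    and orth: "\<And>d e. d \<in> S \<Longrightarrow> e \<in> S \<Longrightarrow> d \<noteq> e \<Longrightarrow> hform G (g d) (g e) = 0"
  shows "hform G (vsum n (\<lambda>e. a e \<cdot>\<^sub>v g e) S) (vsum n (\<lambda>e. b e \<cdot>\<^sub>v g e) S)
    = (\<Sum>e\<in>S. cnj (a e) * b e * hform G (g e) (g e))"
proof -
  have "hform G (vsum n (\<lambda>e. a e \<cdot>\<^sub>v g e) S) (vsum n (\<lambda>e. b e \<cdot>\<^sub>v g e) S)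
    = (\<Sum>d\<in>S. \<Sum>e\<in>S. cnj (a d) * b e * hform G (g d) (g e))"
    using assms(1,3)
    by (simp add: hform_vsum_left hform_vsum_right hform_smult_left hform_smult_right
        sum_distrib_left mult_ac) (rule sum.swap)
  also have "\<dots> = (\<Sum>d\<in>S. \<Sum>e\<in>S. if d = e then cnj (a d) * b e * hform G (g d) (g e) else 0)"
    using orth by (intro sum.cong) auto
  also have "\<dots> = (\<Sum>e\<in>S. cnj (a e) * b e * hform G (g e) (g e))"
    using assms(2) by simp
  finally show ?thesis .
qed

section \<open>The spectral theorem relative to a positive definite form\<close>

locale hpd_form =
  fixes n :: nat and G :: "complex mat"
  assumes G_carrier: "G \<in> carrier_mat n n" and G_hpd: "hermitian_pos_def G"
begin

lemma G_adjoint: "mat_adjoint G = G"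
  using G_hpd by (simp add: hermitian_pos_def_def)

lemma hform_zero_right [simp]: "u \<in> carrier_vec n \<Longrightarrow> hform G u (0\<^sub>v n) = 0"
proof -
  assume "u \<in> carrier_vec n"
  moreover have "0 \<cdot>\<^sub>v 0\<^sub>v n = (0\<^sub>v n :: complex vec)" by (intro eq_vecI) auto
  ultimately show ?thesis
    using hform_smult_right[OF G_carrier, of u "0\<^sub>v n" 0] by simp
qed

lemma hform_self_pos: "u \<in> carrier_vec n \<Longrightarrow> u \<noteq> 0\<^sub>v n \<Longrightarrow> 0 < Re (hform G u u)"
  using G_hpd G_carrier by (simp add: hermitian_pos_def_def hform_def)

lemma hform_self_nonneg: "u \<in> carrier_vec n \<Longrightarrow> 0 \<le> Re (hform G u u)"
  using hform_self_pos[of u] hform_zero_right[of "0\<^sub>v n"] by (cases "u = 0\<^sub>v n") auto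

lemma hform_self_zeroD: "u \<in> carrier_vec n \<Longrightarrow> hform G u u = 0 \<Longrightarrow> u = 0\<^sub>v n"
  using hform_self_pos[of u] by fastforce

text \<open>The usual argument: the form is nonnegative at \<open>u - (Re \<langle>u, v\<rangle> / \<langle>v, v\<rangle>) v\<close>.\<close>

lemma hform_Cauchy_Schwarz:
  assumes u: "u \<in> carrier_vec n" and v: "v \<in> carrier_vec n"
  shows "Re (hform G u v) \<le> sqrt (Re (hform G u u)) * sqrt (Re (hform G v v))"
proof (cases "v = 0\<^sub>v n")
  case True
  then show ?thesis using u by simp
next
  case False
  define a c r where "a = Re (hform G u u)" and "c = Re (hform G v v)" and "r = Re (hform G u v)"
  have c: "0 < c" using hform_self_pos[OF v False] by (simp add: c_def)
  define s where "s = - (r / c)"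
  have vu: "Re (hform G v u) = r"
    using hform_swap[OF G_carrier G_adjoint, of v u] u v by (simp add: r_def)
  have "0 \<le> Re (hform G (u + complex_of_real s \<cdot>\<^sub>v v) (u + complex_of_real s \<cdot>\<^sub>v v))"
    using u v by (intro hform_self_nonneg) auto
  also have "\<dots> = a + 2 * s * r + s\<^sup>2 * c"
    using u v
    by (simp add: hform_add_left[OF G_carrier] hform_add_right[OF G_carrier]
        hform_smult_left[OF G_carrier] hform_smult_right[OF G_carrier]
        a_def r_def[symmetric] c_def vu power2_eq_square algebra_simps)
  finally have "0 \<le> a + 2 * s * r + s\<^sup>2 * c" .
  then have "r\<^sup>2 \<le> a * c"
    using c by (simp add: s_def power2_eq_square field_simps)
  then have "r \<le> sqrt (a * c)"
    by (rule real_le_rsqrt)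
  then show ?thesis
    by (simp add: a_def c_def r_def real_sqrt_mult)
qed

end

lemma eq_vsum_cols:
  assumes "M \<in> carrier_mat n k" "x \<in> carrier_vec k"
  shows "M *\<^sub>v x = vsum n (\<lambda>j. x $ j \<cdot>\<^sub>v col M j) {..<k}"
  using assms by (intro eq_vecI) (auto simp: index_vsum scalar_prod_def atLeast0LessThan mult.commute intro!: sum.cong)

definition real_spectrum :: "complex mat \<Rightarrow> real set" where
  "real_spectrum B = {x. eigenvalue B (complex_of_real x)}"

text \<open>That \<open>G * B\<close> is Hermitian means that \<open>B\<close> is self-adjoint for the inner product given by \<open>G\<close>. For
  \<open>G = I\<close> this is the ordinary notion; for \<open>G = V\<^sup>*V\<close> it covers the compression \<open>V\<^sup>\<dagger>AV\<close>.\<close>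

locale selfadjoint_form = hpd_form +
  fixes B :: "complex mat"
  assumes B_carrier: "B \<in> carrier_mat n n" and GB_adjoint: "mat_adjoint (G * B) = G * B"
begin

abbreviation spec :: "real set" where
  "spec \<equiv> real_spectrum B"

text \<open>One vector for each eigenvalue, either zero or an eigenvector. Keeping one vector per eigenvalue,
  rather than a basis of eigenvectors, makes orthogonality automatic and avoids normalisation.\<close>

definition eigen_split :: "(real \<Rightarrow> complex vec) \<Rightarrow> bool" where
  "eigen_split g \<longleftrightarrow> (\<forall>e\<in>spec. g e \<in> carrier_vec n \<and> B *\<^sub>v g e = complex_of_real e \<cdot>\<^sub>v g e)"

lemma hform_selfadjoint:
  assumes "u \<in> carrier_vec n" "v \<in> carrier_vec n"
  shows "hform G u (B *\<^sub>v v) = hform G (B *\<^sub>v u) v"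
proof -
  have GB: "G * B \<in> carrier_mat n n" using G_carrier B_carrier by simp
  have *: "hform G x (B *\<^sub>v y) = hform (G * B) x y" if "y \<in> carrier_vec n" for x y
    using that G_carrier B_carrier by (simp add: hform_def assoc_mult_mat_vec[of _ n n _ n])
  have "hform G (B *\<^sub>v u) v = cnj (hform G v (B *\<^sub>v u))"
    using assms B_carrier by (intro hform_swap[OF G_carrier G_adjoint]) auto
  also have "\<dots> = cnj (hform (G * B) v u)" using * assms by simp
  also have "\<dots> = hform (G * B) u v" using hform_swap[OF GB GB_adjoint] assms by metis
  finally show ?thesis using * assms by simp
qed

lemma eigenvalue_real:
  assumes "eigenvalue B c"
  shows "c = complex_of_real (Re c)"
proof -
  obtain v where v: "v \<in> carrier_vec n" "v \<noteq> 0\<^sub>v n" "B *\<^sub>v v = c \<cdot>\<^sub>v v"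
    using assms B_carrier unfolding eigenvalue_def eigenvector_def by auto
  have "c * hform G v v = cnj c * hform G v v"
    using hform_selfadjoint[OF v(1) v(1)] v
    by (simp add: hform_smult_left[OF G_carrier] hform_smult_right[OF G_carrier])
  moreover have "hform G v v \<noteq> 0" using hform_self_zeroD v by blast
  ultimately have "c = cnj c" by simp
  from arg_cong[OF this, of Im] have "Im c = 0" by simp
  then show ?thesis by (simp add: complex_eq_iff)
qed

lemma finite_spec: "finite spec"
proof -
  have "char_poly B \<noteq> 0"
    using degree_monic_char_poly[OF B_carrier] by auto
  then have "finite {c. poly (char_poly B) c = 0}"
    by (rule poly_roots_finite)
  moreover have "complex_of_real ` spec \<subseteq> {c. poly (char_poly B) c = 0}"
    using eigenvalue_root_char_poly[OF B_carrier] by (auto simp: real_spectrum_def)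
  ultimately show ?thesis
    by (meson finite_imageD finite_subset inj_of_real inj_on_subset subset_UNIV)
qed

lemma eigenvectors_orthogonal:
  assumes "u \<in> carrier_vec n" "B *\<^sub>v u = complex_of_real d \<cdot>\<^sub>v u"
    and "v \<in> carrier_vec n" "B *\<^sub>v v = complex_of_real e \<cdot>\<^sub>v v" and "d \<noteq> e"
  shows "hform G u v = 0"
proof -
  have "complex_of_real e * hform G u v = complex_of_real d * hform G u v"
    using hform_selfadjoint[of u v] assms
    by (simp add: hform_smult_left[OF G_carrier] hform_smult_right[OF G_carrier])
  then show ?thesis using assms(5) by simp
qed

lemma eigen_split_add:
  assumes "eigen_split g" "eigen_split h"
  shows "eigen_split (\<lambda>e. g e + h e)" "vsum n g spec + vsum n h spec = vsum n (\<lambda>e. g e + h e) spec"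
proof -
  show "eigen_split (\<lambda>e. g e + h e)"
    using assms B_carrier unfolding eigen_split_def
    by (auto simp: mult_add_distrib_mat_vec[of _ n n] smult_add_distrib_vec[of _ n])
  show "vsum n g spec + vsum n h spec = vsum n (\<lambda>e. g e + h e) spec"
  proof (intro eq_vecI)
    fix i assume i: "i < dim_vec (vsum n (\<lambda>e. g e + h e) spec)"
    have "(\<Sum>e\<in>spec. g e $ i) + (\<Sum>e\<in>spec. h e $ i) = (\<Sum>e\<in>spec. (g e + h e) $ i)"
      unfolding sum.distrib[symmetric] using i assms
      by (intro sum.cong) (auto simp: eigen_split_def carrier_vecD)
    then show "(vsum n g spec + vsum n h spec) $ i = vsum n (\<lambda>e. g e + h e) spec $ i"
      using i by (simp add: index_vsum)
  qed simp
qed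

lemma eigen_split_smult:
  assumes "eigen_split g"
  shows "eigen_split (\<lambda>e. c e \<cdot>\<^sub>v g e)"
  using assms B_carrier unfolding eigen_split_def
  by (auto simp: mult_mat_vec[of _ n n] smult_smult_assoc mult.commute)

lemma eigen_split_single:
  assumes "e \<in> spec" "w \<in> carrier_vec n" "B *\<^sub>v w = complex_of_real e \<cdot>\<^sub>v w"
  shows "\<exists>g. eigen_split g \<and> w = vsum n g spec"
proof (intro exI conjI)
  let ?g = "\<lambda>d. if d = e then w else 0\<^sub>v n"
  show "eigen_split ?g"
    using assms B_carrier by (auto simp: eigen_split_def)
  show "w = vsum n ?g spec"
    using assms finite_spec by (intro eq_vecI) (auto simp: index_vsum if_distrib[of "\<lambda>v. v $ _"] cong: if_cong)
qed

lemma eigen_split_zero: "eigen_split (\<lambda>e. 0\<^sub>v n)" "vsum n (\<lambda>e. 0\<^sub>v n) S = 0\<^sub>v n"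
  using B_carrier by (auto simp: eigen_split_def vsum_def)

lemma eigen_split_vsum:
  assumes "finite S" "\<And>i. i \<in> S \<Longrightarrow> h i \<in> carrier_vec n"
    and "\<And>i. i \<in> S \<Longrightarrow> \<exists>g. eigen_split g \<and> h i = vsum n g spec"
  shows "\<exists>g. eigen_split g \<and> vsum n h S = vsum n g spec"
  using assms
proof (induction S rule: finite_induct)
  case empty
  have "vsum n h {} = vsum n (\<lambda>e. 0\<^sub>v n) spec"
    using eigen_split_zero(2)[of spec] by (simp add: vsum_def zero_vec_def)
  then show ?case using eigen_split_zero(1) by blast
next
  case (insert i S)
  obtain g where g: "eigen_split g" "vsum n h S = vsum n g spec"
    using insert by auto
  obtain g' where g': "eigen_split g'" "h i = vsum n g' spec"
    using insert.prems by auto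
  have "vsum n h (insert i S) = h i + vsum n h S"
    using insert.hyps insert.prems(1)[of i] by (intro eq_vecI) (auto simp: index_vsum)
  then show ?case
    using g g' eigen_split_add[of g' g] by auto
qed

lemma hform_eigen_split:
  assumes "eigen_split g"
  shows "hform G (vsum n (\<lambda>e. a e \<cdot>\<^sub>v g e) spec) (vsum n (\<lambda>e. b e \<cdot>\<^sub>v g e) spec)
    = (\<Sum>e\<in>spec. cnj (a e) * b e * hform G (g e) (g e))"
proof -
  have "hform G (g d) (g e) = 0" if "d \<in> spec" "e \<in> spec" "d \<noteq> e" for d e
    using that assms by (intro eigenvectors_orthogonal) (auto simp: eigen_split_def)
  then show ?thesis
    using assms by (intro hform_vsum_orthogonal G_carrier finite_spec) (auto simp: eigen_split_def)
qed

lemma hform_eigen_split_self: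
  assumes "eigen_split g"
  shows "hform G (vsum n g spec) (vsum n g spec) = (\<Sum>e\<in>spec. hform G (g e) (g e))"
  using hform_eigen_split[OF assms, of "\<lambda>_. 1" "\<lambda>_. 1"] by (simp add: vsum_def)

lemma mult_eigen_split:
  assumes "eigen_split g"
  shows "B *\<^sub>v vsum n (\<lambda>e. a e \<cdot>\<^sub>v g e) spec = vsum n (\<lambda>e. (a e * complex_of_real e) \<cdot>\<^sub>v g e) spec"
  using assms B_carrier
  by (subst mult_mat_vec_vsum[of _ n n])
     (auto intro!: vsum_cong simp: eigen_split_def mult_mat_vec[of _ n n] smult_smult_assoc)

text \<open>This step excludes Jordan blocks. After subtracting from \<open>p\<close> the obvious preimages of
  the components \<open>g d\<close> with \<open>d \<noteq> e\<close>, the rest \<open>w\<close> satisfies \<open>(B - e) w = g e\<close> and \<open>(B - e)\<^sup>2 w = 0\<close>.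
  A self-adjoint matrix has no generalised eigenvectors, since
  \<open>\<langle>(B - e) w, (B - e) w\<rangle> = \<langle>w, (B - e)\<^sup>2 w\<rangle> = 0\<close>; so \<open>w\<close> is an eigenvector.\<close>

lemma eigen_split_flag_step:
  assumes e: "e \<in> spec" and p: "p \<in> carrier_vec n" and g: "eigen_split g"
    and Bp: "B *\<^sub>v p = complex_of_real e \<cdot>\<^sub>v p + vsum n g spec"
  shows "\<exists>h. eigen_split h \<and> p = vsum n h spec"
proof -
  \<comment> \<open>\<open>(B - e) q\<close> is the sum of the \<open>g d\<close> with \<open>d \<noteq> e\<close>\<close>
  define a where "a d = (if d = e then 0 else 1 / complex_of_real (d - e))" for d
  define q where "q = vsum n (\<lambda>d. a d \<cdot>\<^sub>v g d) spec"
  define w where "w = p - q"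
  have gc: "\<And>d. d \<in> spec \<Longrightarrow> g d \<in> carrier_vec n"
    and gB: "\<And>d. d \<in> spec \<Longrightarrow> B *\<^sub>v g d = complex_of_real d \<cdot>\<^sub>v g d"
    using g by (auto simp: eigen_split_def)
  have q: "q \<in> carrier_vec n" and w: "w \<in> carrier_vec n" using p by (auto simp: q_def w_def)
  have Bq: "B *\<^sub>v q = vsum n (\<lambda>d. (a d * complex_of_real d) \<cdot>\<^sub>v g d) spec"
    unfolding q_def using g by (rule mult_eigen_split)
  have "B *\<^sub>v w = B *\<^sub>v p - B *\<^sub>v q"
    unfolding w_def using B_carrier p q by (rule mult_minus_distrib_mat_vec)
  also have "\<dots> = complex_of_real e \<cdot>\<^sub>v w + g e"
  proof (intro eq_vecI)
    fix i assume "i < dim_vec (complex_of_real e \<cdot>\<^sub>v w + g e)"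
    then have i: "i < n" using gc[OF e] by simp
    have "(\<Sum>d\<in>spec. g d $ i) - (\<Sum>d\<in>spec. a d * complex_of_real d * g d $ i)
        + complex_of_real e * (\<Sum>d\<in>spec. a d * g d $ i)
      = (\<Sum>d\<in>spec. g d $ i - a d * complex_of_real d * g d $ i + complex_of_real e * (a d * g d $ i))"
      by (simp add: sum.distrib sum_subtractf sum_distrib_left)
    also have "\<dots> = (\<Sum>d\<in>spec. if d = e then g d $ i else 0)"
      by (intro sum.cong) (auto simp: a_def field_simps of_real_diff)
    also have "\<dots> = g e $ i" using e finite_spec by simp
    finally have "(\<Sum>d\<in>spec. g d $ i) - (\<Sum>d\<in>spec. a d * complex_of_real d * g d $ i)
        + complex_of_real e * (\<Sum>d\<in>spec. a d * g d $ i) = g e $ i" .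
    moreover have "(B *\<^sub>v q) $ i = (\<Sum>d\<in>spec. a d * complex_of_real d * g d $ i)"
      "q $ i = (\<Sum>d\<in>spec. a d * g d $ i)" "w $ i = p $ i - q $ i"
      unfolding Bq using i p by (simp_all add: w_def q_def index_vsum carrier_vecD[OF gc])
    moreover have "(B *\<^sub>v p) $ i = complex_of_real e * p $ i + (\<Sum>d\<in>spec. g d $ i)"
      unfolding Bp using i p by (simp add: index_vsum)
    ultimately show "(B *\<^sub>v p - B *\<^sub>v q) $ i = (complex_of_real e \<cdot>\<^sub>v w + g e) $ i"
      using i w q p B_carrier carrier_vecD[OF gc[OF e]]
      by (simp del: index_mult_mat_vec) (simp add: algebra_simps)
  qed (use B_carrier gc[OF e] in auto)
  finally have Bw: "B *\<^sub>v w = complex_of_real e \<cdot>\<^sub>v w + g e" .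
  have "hform G (g e) (B *\<^sub>v w) = complex_of_real e * hform G (g e) w"
    using hform_selfadjoint[OF gc[OF e] w] gB[OF e] gc[OF e] w
    by (simp add: hform_smult_left[OF G_carrier])
  then have "hform G (g e) (g e) = 0"
    unfolding Bw using gc[OF e] w
    by (simp add: hform_add_right[OF G_carrier] hform_smult_right[OF G_carrier])
  then have "g e = 0\<^sub>v n" using gc[OF e] hform_self_zeroD by blast
  then have "B *\<^sub>v w = complex_of_real e \<cdot>\<^sub>v w" using Bw w by simp
  then obtain h where h: "eigen_split h" "w = vsum n h spec"
    using eigen_split_single e w by blast
  have "p = w + q" using p q by (auto simp: w_def)
  then show ?thesis
    using eigen_split_add[OF h(1) eigen_split_smult[OF g]] h(2) unfolding q_def by auto
qed

text \<open>The spectral theorem. A Schur triangularisation \<open>B = P T P\<^sup>-\<^sup>1\<close> gives a flag of invariant subspaces: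
  \<open>B\<close> maps the \<open>j\<close>-th column of \<open>P\<close> to \<open>T\<^sub>j\<^sub>j\<close> times itself plus a combination of the earlier columns.
  By induction along the flag every column splits into eigenvectors, and the columns span.\<close>

lemma eigen_split_exists:
  assumes v: "v \<in> carrier_vec n"
  shows "\<exists>g. eigen_split g \<and> v = vsum n g spec"
proof -
  obtain es where es: "char_poly B = (\<Prod>e\<leftarrow>es. [:- e, 1:])"
    using char_poly_factorized[OF B_carrier] by auto
  obtain T P Q where TPQ: "schur_decomposition B es = (T, P, Q)"
    by (cases "schur_decomposition B es") auto
  have sim: "similar_mat_wit B T P Q" and ut: "upper_triangular T" and diag: "diag_mat T = es"
    using schur_decomposition[OF B_carrier es TPQ] by auto
  have PQ: "P * Q = 1\<^sub>m n" "Q * P = 1\<^sub>m n" "B = P * T * Q"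
    and carr: "T \<in> carrier_mat n n" "P \<in> carrier_mat n n" "Q \<in> carrier_mat n n"
    using similar_mat_witD2[OF B_carrier sim] by auto
  have BP: "B * P = P * T"
  proof -
    have "B * P = P * T * (Q * P)"
      unfolding PQ(3) using carr by (simp add: assoc_mult_mat[of _ n n _ n _ n])
    then show ?thesis using carr PQ(2) by simp
  qed
  have cols: "\<exists>g. eigen_split g \<and> col P j = vsum n g spec" if "j < n" for j
    using that
  proof (induction j rule: less_induct)
    case (less j)
    have "T $$ (j, j) \<in> set es"
      using less.prems carr unfolding diag[symmetric] diag_mat_def by auto
    \<comment> \<open>the diagonal of \<open>T\<close> consists of eigenvalues, which are real by self-adjointness\<close>
    then have "poly (char_poly B) (T $$ (j, j)) = 0"
      unfolding es by (auto simp: poly_prod_list prod_list_zero_iff)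
    then have ev: "eigenvalue B (T $$ (j, j))"
      using eigenvalue_root_char_poly[OF B_carrier] by simp
    define e where "e = Re (T $$ (j, j))"
    have Tjj: "T $$ (j, j) = complex_of_real e" and e: "e \<in> spec"
      using eigenvalue_real[OF ev] ev by (auto simp: e_def real_spectrum_def)
    have "\<exists>g. eigen_split g \<and> vsum n (\<lambda>i. T $$ (i, j) \<cdot>\<^sub>v col P i) {..<j} = vsum n g spec"
    proof (rule eigen_split_vsum)
      fix i assume i: "i \<in> {..<j}"
      then obtain g where "eigen_split g" "col P i = vsum n g spec"
        using less by auto
      moreover have "T $$ (i, j) \<cdot>\<^sub>v vsum n g spec = vsum n (\<lambda>e. T $$ (i, j) \<cdot>\<^sub>v g e) spec"
        using calculation(1)
        by (intro eq_vecI) (auto simp: index_vsum sum_distrib_left eigen_split_def carrier_vecD intro!: sum.cong)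
      ultimately show "\<exists>g. eigen_split g \<and> T $$ (i, j) \<cdot>\<^sub>v col P i = vsum n g spec"
        using eigen_split_smult[of g "\<lambda>_. T $$ (i, j)"] by auto
    qed (use carr less.prems in auto)
    then obtain g where g: "eigen_split g"
      "vsum n (\<lambda>i. T $$ (i, j) \<cdot>\<^sub>v col P i) {..<j} = vsum n g spec" by blast
    have "B *\<^sub>v col P j = col (P * T) j"
      unfolding BP[symmetric] using B_carrier carr less.prems by (subst col_mult2[of _ n n _ n]) auto
    also have "\<dots> = P *\<^sub>v col T j"
      using carr less.prems by (subst col_mult2[of _ n n _ n]) auto
    also have "\<dots> = vsum n (\<lambda>i. T $$ (i, j) \<cdot>\<^sub>v col P i) {..<n}"
      using carr less.prems
      by (subst eq_vsum_cols[of _ n n]) (auto intro!: vsum_cong)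
    also have "\<dots> = complex_of_real e \<cdot>\<^sub>v col P j + vsum n (\<lambda>i. T $$ (i, j) \<cdot>\<^sub>v col P i) {..<j}"
    proof (intro eq_vecI)
      fix r assume "r < dim_vec (complex_of_real e \<cdot>\<^sub>v col P j + vsum n (\<lambda>i. T $$ (i, j) \<cdot>\<^sub>v col P i) {..<j})"
      then have r: "r < n" by simp
      have "(\<Sum>i<n. T $$ (i, j) * P $$ (r, i)) = (\<Sum>i\<in>{..<Suc j}. T $$ (i, j) * P $$ (r, i))"
        using less.prems ut carr by (intro sum.mono_neutral_right) auto
      then show "vsum n (\<lambda>i. T $$ (i, j) \<cdot>\<^sub>v col P i) {..<n} $ r
        = (complex_of_real e \<cdot>\<^sub>v col P j + vsum n (\<lambda>i. T $$ (i, j) \<cdot>\<^sub>v col P i) {..<j}) $ r"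
        using r carr less.prems by (simp add: index_vsum Tjj)
    qed (use carr in auto)
    finally have "B *\<^sub>v col P j = complex_of_real e \<cdot>\<^sub>v col P j + vsum n g spec"
      using g(2) by simp
    then show ?case
      using eigen_split_flag_step[OF e _ g(1)] carr less.prems by auto
  qed
  have "v = (P * Q) *\<^sub>v v" using PQ v by simp
  also have "\<dots> = P *\<^sub>v (Q *\<^sub>v v)" using carr v by (simp add: assoc_mult_mat_vec[of _ n n _ n])
  also have "\<dots> = vsum n (\<lambda>j. (Q *\<^sub>v v) $ j \<cdot>\<^sub>v col P j) {..<n}"
    using carr v by (intro eq_vsum_cols) auto
  finally have v_eq: "v = vsum n (\<lambda>j. (Q *\<^sub>v v) $ j \<cdot>\<^sub>v col P j) {..<n}" .
  have "\<exists>g. eigen_split g \<and> vsum n (\<lambda>j. (Q *\<^sub>v v) $ j \<cdot>\<^sub>v col P j) {..<n} = vsum n g spec"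
  proof (rule eigen_split_vsum)
    fix j assume j: "j \<in> {..<n}"
    then obtain g where "eigen_split g" "col P j = vsum n g spec"
      using cols by auto
    moreover have "(Q *\<^sub>v v) $ j \<cdot>\<^sub>v vsum n g spec = vsum n (\<lambda>e. (Q *\<^sub>v v) $ j \<cdot>\<^sub>v g e) spec"
      using calculation(1)
      by (intro eq_vecI) (auto simp: index_vsum sum_distrib_left eigen_split_def carrier_vecD intro!: sum.cong)
    ultimately show "\<exists>g. eigen_split g \<and> (Q *\<^sub>v v) $ j \<cdot>\<^sub>v col P j = vsum n g spec"
      using eigen_split_smult[of g "\<lambda>_. (Q *\<^sub>v v) $ j"] by auto
  qed (use carr in auto)
  then show ?thesis using v_eq by simp
qed

end

section \<open>Chebyshev polynomials and the conjugate gradient rate\<close>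

fun cheb_poly :: "nat \<Rightarrow> real poly" where
  "cheb_poly 0 = 1"
| "cheb_poly (Suc 0) = [:0, 1:]"
| "cheb_poly (Suc (Suc n)) = [:0, 2:] * cheb_poly (Suc n) - cheb_poly n"

lemma degree_cheb_poly: "degree (cheb_poly n) \<le> n"
proof (induction n rule: cheb_poly.induct)
  case (3 n)
  have "degree ([:0, 2:] * cheb_poly (Suc n)) \<le> Suc (Suc n)"
    using degree_mult_le[of "[:0, 2:]" "cheb_poly (Suc n)"] 3 by simp
  then show ?case
    using 3 by (auto intro!: degree_diff_le)
qed auto

lemma cheb_poly_cos: "poly (cheb_poly n) (cos x) = cos (real n * x)"
proof (induction n rule: cheb_poly.induct)
  case (3 n)
  have "cos (real (Suc n) * x + x) + cos (real (Suc n) * x - x) = 2 * cos x * cos (real (Suc n) * x)"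
    by (simp add: cos_add cos_diff)
  moreover have "real (Suc n) * x + x = real (Suc (Suc n)) * x" "real (Suc n) * x - x = real n * x"
    by (simp_all add: algebra_simps)
  ultimately show ?case using 3 by simp
qed auto

lemma cheb_poly_cosh: "poly (cheb_poly n) (cosh x) = cosh (real n * x)"
proof (induction n rule: cheb_poly.induct)
  case (3 n)
  have "cosh (real (Suc n) * x + x) + cosh (real (Suc n) * x - x) = 2 * cosh x * cosh (real (Suc n) * x)"
    by (simp add: cosh_add cosh_diff)
  moreover have "real (Suc n) * x + x = real (Suc (Suc n)) * x" "real (Suc n) * x - x = real n * x"
    by (simp_all add: algebra_simps)
  ultimately show ?case using 3 by simp
qed auto

lemma abs_cheb_poly_le_1:
  assumes "\<bar>y\<bar> \<le> 1"
  shows "\<bar>poly (cheb_poly n) y\<bar> \<le> 1"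
  using cheb_poly_cos[of n "arccos y"] assms by (simp add: cos_arccos_abs)

text \<open>The convergence factor of the conjugate gradient method for a spectrum in \<open>[l + t, u + t]\<close>.\<close>

definition conv_rate :: "real \<Rightarrow> real \<Rightarrow> real \<Rightarrow> real" where
  "conv_rate l u t = (sqrt ((u + t) / (l + t)) - 1) / (sqrt ((u + t) / (l + t)) + 1)"

lemma conv_rate_bounds:
  assumes "0 < l" "l < u" "0 \<le> t"
  shows "0 < conv_rate l u t" "conv_rate l u t < 1"
proof -
  have "1 < sqrt ((u + t) / (l + t))" using assms by (simp add: field_simps)
  then show "0 < conv_rate l u t" "conv_rate l u t < 1"
    unfolding conv_rate_def by (simp_all add: divide_less_eq_1 zero_less_divide_iff del: real_sqrt_gt_1_iff)
qed

lemma conv_rate_eq_0 [simp]: "0 < l \<Longrightarrow> 0 \<le> t \<Longrightarrow> conv_rate l l t = 0"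
  by (simp add: conv_rate_def)

lemma conv_rate_antimono:
  assumes "0 < l" "l \<le> u" "0 \<le> s" "s \<le> t"
  shows "conv_rate l u t \<le> conv_rate l u s"
proof -
  define a b where "a = sqrt ((u + t) / (l + t))" and "b = sqrt ((u + s) / (l + s))"
  have "0 \<le> (u - l) * (t - s)" using assms by simp
  then have "(u + t) / (l + t) \<le> (u + s) / (l + s)"
    using assms by (simp add: divide_simps algebra_simps)
  then have ab: "a \<le> b" by (simp add: a_def b_def)
  have "0 \<le> a" using assms by (simp add: a_def)
  have "(a - 1) / (a + 1) \<le> (b - 1) / (b + 1)"
    using ab \<open>0 \<le> a\<close> by (simp add: divide_simps algebra_simps)
  then show ?thesis by (simp add: conv_rate_def a_def b_def)
qed

text \<open>The decreasing affine map from \<open>[l, u]\<close> onto \<open>[-1, 1]\<close> takes \<open>- t\<close> to the right-hand side. This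
  identity is the reason for the shape of \<open>c(t)\<close> and of \<open>\<alpha>\<^sub>m\<close>: the Chebyshev polynomial of degree
  \<open>m\<close> has the value \<open>cosh (m ln c(t))\<close> at that point.\<close>

lemma cosh_ln_conv_rate:
  assumes "0 < l" "l < u" "0 \<le> t"
  shows "cosh (ln (conv_rate l u t)) = (u + l + 2 * t) / (u - l)"
proof -
  define k where "k = sqrt ((u + t) / (l + t))"
  have k: "1 < k" using assms by (simp add: k_def field_simps)
  have k2: "k\<^sup>2 = (u + t) / (l + t)" using assms by (simp add: k_def)
  have c: "conv_rate l u t = (k - 1) / (k + 1)" by (simp add: conv_rate_def k_def)
  have "cosh (ln (conv_rate l u t)) = ((k - 1) / (k + 1) + (k + 1) / (k - 1)) / 2"
    using conv_rate_bounds[OF assms] by (simp add: cosh_ln_real c inverse_eq_divide)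
  also have "\<dots> = (k\<^sup>2 + 1) / (k\<^sup>2 - 1)"
  proof -
    have "k + 1 \<noteq> 0" "k - 1 \<noteq> 0" "k\<^sup>2 - 1 = (k + 1) * (k - 1)"
      using k by (auto simp: power2_eq_square algebra_simps)
    then show ?thesis by (simp add: divide_simps power2_eq_square algebra_simps)
  qed
  also have "\<dots> = (u + l + 2 * t) / (u - l)"
  proof -
    have "(u + t) / (l + t) + 1 = (u + l + 2 * t) / (l + t)" "(u + t) / (l + t) - 1 = (u - l) / (l + t)"
      using assms by (simp_all add: field_simps)
    then show ?thesis unfolding k2 using assms by simp
  qed
  finally show ?thesis .
qed

text \<open>The polynomial \<open>1 - (e + t) r(e)\<close> in \<open>e\<close> is an arbitrary polynomial of degree at most \<open>m\<close> with the
  value \<open>1\<close> at \<open>- t\<close>. The smallest one on \<open>[l, u]\<close> is the Chebyshev polynomial transported to that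
  interval and scaled. If \<open>l = u\<close>, a linear polynomial has its root there, which needs \<open>m \<ge> 1\<close>.\<close>

lemma residual_poly_exists:
  assumes lu: "0 < l" "l \<le> u" and t: "0 \<le> t" and m: "1 \<le> m"
  shows "\<exists>r::real poly. degree r < m \<and>
    (\<forall>e\<in>{l..u}. \<bar>1 - (e + t) * poly r e\<bar> \<le>
      (if conv_rate l u t = 0 then 0 else 1 / cosh (real m * ln (conv_rate l u t))))"
proof (cases "l = u")
  case True
  then show ?thesis using assms by (intro exI[of _ "[:1 / (l + t):]"]) auto
next
  case False
  then have lu': "l < u" using lu by simp
  define D where "D = cosh (real m * ln (conv_rate l u t))"
  have D: "1 \<le> D" unfolding D_def by (rule cosh_real_ge_1)
  \<comment> \<open>the Chebyshev polynomial on \<open>[l, u]\<close> instead of \<open>[-1, 1]\<close>, scaled to the value \<open>1\<close> at \<open>- t\<close>\<close>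
  define P where "P = Polynomial.smult (1 / D) (pcompose (cheb_poly m) [:(u + l) / (u - l), - 2 / (u - l):])"
  have P: "poly P e = poly (cheb_poly m) ((u + l - 2 * e) / (u - l)) / D" for e
    using lu' by (simp add: P_def poly_pcompose diff_divide_distrib mult.commute)
  have "poly P (- t) = 1"
    unfolding P using cosh_ln_conv_rate[OF lu(1) lu' t] cheb_poly_cosh[of m "ln (conv_rate l u t)"] D
    by (simp add: D_def)
  then have "[:- (- t), 1:] dvd 1 - P"
    by (subst poly_eq_0_iff_dvd[symmetric]) simp
  then obtain r where r: "1 - P = [:t, 1:] * r" by (auto elim: dvdE)
  have "degree P \<le> m"
    unfolding P_def using degree_cheb_poly[of m] lu'
    by (intro order.trans[OF degree_smult_le]) (simp add: degree_pcompose)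
  then have "degree (1 - P) \<le> m"
    by (intro degree_diff_le) auto
  then have deg: "degree r < m"
    using m degree_mult_eq[of "[:t, 1:]" r] unfolding r by (cases "r = 0") simp_all
  have "\<bar>1 - (e + t) * poly r e\<bar> \<le> 1 / D" if "e \<in> {l..u}" for e
  proof -
    have "1 - poly P e = (t + e) * poly r e"
      using arg_cong[OF r, of "\<lambda>p. poly p e"] by (simp add: distrib_right)
    then have "1 - (e + t) * poly r e = poly P e" by (simp add: algebra_simps)
    moreover have "\<bar>poly (cheb_poly m) ((u + l - 2 * e) / (u - l))\<bar> \<le> 1"
      using that lu' by (intro abs_cheb_poly_le_1) (auto simp: abs_le_iff field_simps)
    ultimately show ?thesis
      unfolding P using D by (simp add: divide_right_mono)
  qed
  moreover have "conv_rate l u t \<noteq> 0" using conv_rate_bounds[OF lu(1) lu' t] by simp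
  ultimately show ?thesis using deg by (auto simp: D_def)
qed

lemma cosh_ln_antimono:
  assumes "0 < c" "c \<le> d" "d < (1::real)"
  shows "cosh (real m * ln d) \<le> cosh (real m * ln c)"
proof -
  have "ln c \<le> ln d" "ln d \<le> 0" using assms by auto
  then have "\<bar>real m * ln d\<bar> \<le> \<bar>real m * ln c\<bar>" by (simp add: abs_mult mult_left_mono)
  then have "cosh \<bar>real m * ln d\<bar> \<le> cosh \<bar>real m * ln c\<bar>"
    by (subst cosh_real_nonneg_le_iff) auto
  then show ?thesis by simp
qed

section \<open>Resolvents and their integrals\<close>

lemma mat_inv:
  assumes M: "M \<in> carrier_mat n n"
    and inj: "\<And>v. v \<in> carrier_vec n \<Longrightarrow> M *\<^sub>v v = 0\<^sub>v n \<Longrightarrow> v = 0\<^sub>v n"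
  shows "mat_inv M \<in> carrier_mat n n" "mat_inv M * M = 1\<^sub>m n" "M * mat_inv M = 1\<^sub>m n"
proof -
  have "det M \<noteq> 0"
    using inj det_0_iff_vec_prod_zero_field[OF M] by blast
  then have "M \<in> Units (ring_mat TYPE(complex) n ())"
    using det_non_zero_imp_unit[OF M, of "()"] by simp
  then obtain L where "mat_inverse M = Some L"
    using mat_inverse(1)[OF M, where b = "()"] by (cases "mat_inverse M") auto
  then show "mat_inv M \<in> carrier_mat n n" "mat_inv M * M = 1\<^sub>m n" "M * mat_inv M = 1\<^sub>m n"
    using mat_inverse(2)[OF M] by (auto simp: mat_inv_def)
qed

lemma shift_mult_mat_vec:
  fixes M :: "complex mat"
  assumes "M \<in> carrier_mat n n" "v \<in> carrier_vec n"
  shows "(M + c \<cdot>\<^sub>m 1\<^sub>m n) *\<^sub>v v = M *\<^sub>v v + c \<cdot>\<^sub>v v"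
proof -
  have "(c \<cdot>\<^sub>m 1\<^sub>m n) *\<^sub>v v = c \<cdot>\<^sub>v v"
  proof (intro eq_vecI)
    fix i assume "i < dim_vec (c \<cdot>\<^sub>v v)"
    then show "((c \<cdot>\<^sub>m 1\<^sub>m n) *\<^sub>v v) $ i = (c \<cdot>\<^sub>v v) $ i"
      using assms
      by (auto simp: scalar_prod_def row_smult if_distrib[of "\<lambda>x. c * x * _"] cong: if_cong)
  qed (use assms in auto)
  then show ?thesis using assms by (simp add: add_mult_distrib_mat_vec[of _ n n])
qed

lemma space_stieltjes_measure:
  assumes "stieltjes_measure t0 \<mu>"
  shows "space \<mu> = {t0..}"
  using assms sets_eq_imp_space_eq[of \<mu> "restrict_space borel {t0..}"]
  by (simp add: stieltjes_measure_def space_restrict_space)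

lemma index_mult_unit_vec:
  assumes "M \<in> carrier_mat k n" "i < k" "j < n"
  shows "(M *\<^sub>v unit_vec n j) $ i = (M :: complex mat) $$ (i, j)"
  using assms by simp

context selfadjoint_form
begin

lemma spec_pos:
  assumes GB: "hermitian_pos_def (G * B)" and e: "e \<in> spec"
  shows "0 < e"
proof -
  obtain v where v: "v \<in> carrier_vec n" "v \<noteq> 0\<^sub>v n" "B *\<^sub>v v = complex_of_real e \<cdot>\<^sub>v v"
    using e B_carrier unfolding real_spectrum_def eigenvalue_def eigenvector_def by auto
  have "0 < Re (conjugate v \<bullet> (G * B *\<^sub>v v))"
    using GB v(1,2) G_carrier by (simp add: hermitian_pos_def_def del: assoc_mult_mat_vec)
  also have "conjugate v \<bullet> (G * B *\<^sub>v v) = hform G v (B *\<^sub>v v)"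
    using v G_carrier B_carrier by (simp only: hform_def assoc_mult_mat_vec[of _ n n _ n])
  also have "\<dots> = complex_of_real e * hform G v v"
    using v by (simp add: hform_smult_right[OF G_carrier])
  finally have "0 < e * Re (hform G v v)" by simp
  then show ?thesis
    using hform_self_pos[OF v(1,2)] by (simp add: zero_less_mult_iff)
qed

lemma shift_inverse:
  assumes "\<And>e. e \<in> spec \<Longrightarrow> e + t \<noteq> 0"
  defines "L \<equiv> B + complex_of_real t \<cdot>\<^sub>m 1\<^sub>m n"
  shows "mat_inv L \<in> carrier_mat n n" "mat_inv L * L = 1\<^sub>m n" "L * mat_inv L = 1\<^sub>m n"
proof -
  have L: "L \<in> carrier_mat n n" using B_carrier by (simp add: L_def)
  have inj: "v = 0\<^sub>v n" if v: "v \<in> carrier_vec n" "L *\<^sub>v v = 0\<^sub>v n" for v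
  proof (rule ccontr)
    assume "v \<noteq> 0\<^sub>v n"
    have "B *\<^sub>v v + complex_of_real t \<cdot>\<^sub>v v = 0\<^sub>v n"
      using v shift_mult_mat_vec[OF B_carrier] by (simp add: L_def)
    then have *: "(B *\<^sub>v v) $ i + complex_of_real t * v $ i = 0" if "i < n" for i
      using that v B_carrier
      by (metis index_add_vec(1) index_smult_vec(1,2) index_zero_vec(1) carrier_vecD)
    have "B *\<^sub>v v = complex_of_real (- t) \<cdot>\<^sub>v v"
      using *[THEN add_eq_0_iff2[THEN iffD1]] v B_carrier
      by (intro eq_vecI) (auto simp del: index_mult_mat_vec)
    then have "eigenvector B v (complex_of_real (- t))"
      unfolding eigenvector_def using v B_carrier \<open>v \<noteq> 0\<^sub>v n\<close> by auto
    then have "- t \<in> spec" unfolding real_spectrum_def eigenvalue_def by blast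
    then show False using assms(1) by fastforce
  qed
  show "mat_inv L \<in> carrier_mat n n" "mat_inv L * L = 1\<^sub>m n" "L * mat_inv L = 1\<^sub>m n"
    using mat_inv[OF L inj] by blast+
qed

lemma shift_eigen_split:
  assumes g: "eigen_split g"
  shows "(B + complex_of_real t \<cdot>\<^sub>m 1\<^sub>m n) *\<^sub>v vsum n (\<lambda>e. a e \<cdot>\<^sub>v g e) spec
    = vsum n (\<lambda>e. (a e * complex_of_real (e + t)) \<cdot>\<^sub>v g e) spec"
proof -
  have gc: "\<And>e. e \<in> spec \<Longrightarrow> g e \<in> carrier_vec n"
    using g by (auto simp: eigen_split_def)
  show ?thesis
    unfolding shift_mult_mat_vec[OF B_carrier vsum_carrier] mult_eigen_split[OF g]
  proof (intro eq_vecI)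
    fix i assume "i < dim_vec (vsum n (\<lambda>e. (a e * complex_of_real (e + t)) \<cdot>\<^sub>v g e) spec)"
    then have i: "i < n" by simp
    have "(\<Sum>e\<in>spec. a e * complex_of_real e * g e $ i) + complex_of_real t * (\<Sum>e\<in>spec. a e * g e $ i)
        = (\<Sum>e\<in>spec. a e * complex_of_real e * g e $ i + complex_of_real t * (a e * g e $ i))"
      by (simp only: sum_distrib_left sum.distrib)
    also have "\<dots> = (\<Sum>e\<in>spec. a e * complex_of_real (e + t) * g e $ i)"
      by (intro sum.cong) (auto simp: algebra_simps)
    finally show "(vsum n (\<lambda>e. (a e * complex_of_real e) \<cdot>\<^sub>v g e) spec
        + complex_of_real t \<cdot>\<^sub>v vsum n (\<lambda>e. a e \<cdot>\<^sub>v g e) spec) $ i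
        = vsum n (\<lambda>e. (a e * complex_of_real (e + t)) \<cdot>\<^sub>v g e) spec $ i"
      using i by (simp add: index_vsum carrier_vecD[OF gc] del: of_real_add)
  qed simp
qed

lemma resolvent_eigen_split:
  assumes t: "\<And>e. e \<in> spec \<Longrightarrow> e + t \<noteq> 0" and g: "eigen_split g"
  shows "mat_inv (B + complex_of_real t \<cdot>\<^sub>m 1\<^sub>m n) *\<^sub>v vsum n g spec
    = vsum n (\<lambda>e. complex_of_real (1 / (e + t)) \<cdot>\<^sub>v g e) spec"
proof -
  define L where "L = B + complex_of_real t \<cdot>\<^sub>m 1\<^sub>m n"
  have L: "L \<in> carrier_mat n n" using B_carrier by (simp add: L_def)
  note inv = shift_inverse[OF t, folded L_def]
  let ?x = "vsum n (\<lambda>e. complex_of_real (1 / (e + t)) \<cdot>\<^sub>v g e) spec"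
  have "L *\<^sub>v ?x
      = vsum n (\<lambda>e. (complex_of_real (1 / (e + t)) * complex_of_real (e + t)) \<cdot>\<^sub>v g e) spec"
    unfolding L_def using g by (rule shift_eigen_split)
  also have "\<dots> = vsum n g spec"
    using t by (intro vsum_cong) (simp flip: of_real_mult del: of_real_add of_real_divide)
  finally have "L *\<^sub>v ?x = vsum n g spec" .
  then have "mat_inv L *\<^sub>v vsum n g spec = (mat_inv L * L) *\<^sub>v ?x"
    using L inv(1) by (simp add: assoc_mult_mat_vec[of _ n n _ n])
  then show ?thesis using inv(2) by (simp add: L_def)
qed

text \<open>By the spectral theorem each entry is a finite combination of the functions \<open>1 / (e + t)\<close> with
  coefficients independent of \<open>t\<close>, and these are integrable by the definition of a Stieltjes measure,
  because \<open>e > 0\<close>.\<close>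

lemma integrable_resolvent_entry:
  assumes \<mu>: "stieltjes_measure t0 \<mu>" "0 \<le> t0" and pos: "\<And>e. e \<in> spec \<Longrightarrow> 0 < e"
    and ij: "i < n" "j < n"
  shows "integrable \<mu> (\<lambda>t. mat_inv (B + complex_of_real t \<cdot>\<^sub>m 1\<^sub>m n) $$ (i, j))"
proof -
  obtain g where g: "eigen_split g" "unit_vec n j = vsum n g spec"
    using eigen_split_exists[of "unit_vec n j"] by auto
  have entry: "mat_inv (B + complex_of_real t \<cdot>\<^sub>m 1\<^sub>m n) $$ (i, j)
      = (\<Sum>e\<in>spec. complex_of_real (1 / (e + t)) * g e $ i)" if "t \<in> space \<mu>" for t
  proof -
    have t: "0 \<le> t" using that \<mu>(2) space_stieltjes_measure[OF \<mu>(1)] by simp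
    have *: "e + t \<noteq> 0" if "e \<in> spec" for e using pos[OF that] t by simp
    have "mat_inv (B + complex_of_real t \<cdot>\<^sub>m 1\<^sub>m n) $$ (i, j)
      = (mat_inv (B + complex_of_real t \<cdot>\<^sub>m 1\<^sub>m n) *\<^sub>v unit_vec n j) $ i"
      using shift_inverse(1)[OF *] ij by (subst index_mult_unit_vec) auto
    also have "\<dots> = vsum n (\<lambda>e. complex_of_real (1 / (e + t)) \<cdot>\<^sub>v g e) spec $ i"
      unfolding g(2) by (subst resolvent_eigen_split[OF * g(1)]) auto
    also have "\<dots> = (\<Sum>e\<in>spec. complex_of_real (1 / (e + t)) * g e $ i)"
      using g(1) ij
      by (auto simp: index_vsum eigen_split_def carrier_vecD simp del: of_real_divide intro!: sum.cong)
    finally show ?thesis .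
  qed
  have "integrable \<mu> (\<lambda>t. \<Sum>e\<in>spec. complex_of_real (1 / (e + t)) * g e $ i)"
    using \<mu>(1) pos
    by (intro Bochner_Integration.integrable_sum integrable_mult_left integrable_of_real)
       (simp add: stieltjes_measure_def)
  then show ?thesis
    by (subst Bochner_Integration.integrable_cong[OF refl entry])
qed

end

text \<open>Transfers the entrywise matrix integral to the vectors \<open>(B + tI)\<^sup>-\<^sup>1v\<close>.\<close>

lemma stieltjes_mat_fun_mult_vec:
  assumes B: "B \<in> carrier_mat n n" and v: "v \<in> carrier_vec n" and i: "i < n"
    and int: "\<And>i j. i < n \<Longrightarrow> j < n \<Longrightarrow>
      integrable \<mu> (\<lambda>t. mat_inv (B + complex_of_real t \<cdot>\<^sub>m 1\<^sub>m n) $$ (i, j))"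
    and carr: "\<And>t. t \<in> space \<mu> \<Longrightarrow> mat_inv (B + complex_of_real t \<cdot>\<^sub>m 1\<^sub>m n) \<in> carrier_mat n n"
  shows "integrable \<mu> (\<lambda>t. (mat_inv (B + complex_of_real t \<cdot>\<^sub>m 1\<^sub>m n) *\<^sub>v v) $ i)"
    and "(stieltjes_mat_fun \<mu> B *\<^sub>v v) $ i
      = (LINT t|\<mu>. (mat_inv (B + complex_of_real t \<cdot>\<^sub>m 1\<^sub>m n) *\<^sub>v v) $ i)"
proof -
  let ?R = "\<lambda>t. mat_inv (B + complex_of_real t \<cdot>\<^sub>m 1\<^sub>m n)"
  have eq: "(?R t *\<^sub>v v) $ i = (\<Sum>j<n. ?R t $$ (i, j) * v $ j)" if "t \<in> space \<mu>" for t
    using carr[OF that] v i by (simp add: scalar_prod_def atLeast0LessThan)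
  have ints: "integrable \<mu> (\<lambda>t. ?R t $$ (i, j) * v $ j)" if "j < n" for j
    using int[OF i that] by (rule integrable_mult_left)
  have "integrable \<mu> (\<lambda>t. \<Sum>j<n. ?R t $$ (i, j) * v $ j)"
    using ints by (intro Bochner_Integration.integrable_sum) auto
  then show "integrable \<mu> (\<lambda>t. (?R t *\<^sub>v v) $ i)"
    by (subst Bochner_Integration.integrable_cong[OF refl eq])
  have "(stieltjes_mat_fun \<mu> B *\<^sub>v v) $ i = (\<Sum>j<n. (LINT t|\<mu>. ?R t $$ (i, j)) * v $ j)"
    using B v i by (simp add: stieltjes_mat_fun_def scalar_prod_def atLeast0LessThan)
  also have "\<dots> = (LINT t|\<mu>. (\<Sum>j<n. ?R t $$ (i, j) * v $ j))"
    using ints int[OF i] by (subst Bochner_Integration.integral_sum) auto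
  also have "\<dots> = (LINT t|\<mu>. (?R t *\<^sub>v v) $ i)"
    using eq by (intro Bochner_Integration.integral_cong) auto
  finally show "(stieltjes_mat_fun \<mu> B *\<^sub>v v) $ i = (LINT t|\<mu>. (?R t *\<^sub>v v) $ i)" .
qed

lemma integral_mult_mat_vec:
  fixes V :: "complex mat"
  assumes V: "V \<in> carrier_mat k n" and i: "i < k" and E: "E \<in> carrier_vec n"
    and f: "\<And>t. t \<in> space \<mu> \<Longrightarrow> f t \<in> carrier_vec n"
    and int: "\<And>j. j < n \<Longrightarrow> integrable \<mu> (\<lambda>t. f t $ j)"
    and eq: "\<And>j. j < n \<Longrightarrow> E $ j = (LINT t|\<mu>. f t $ j)"
  shows "integrable \<mu> (\<lambda>t. (V *\<^sub>v f t) $ i)" "(V *\<^sub>v E) $ i = (LINT t|\<mu>. (V *\<^sub>v f t) $ i)"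
proof -
  have vf: "(V *\<^sub>v f t) $ i = (\<Sum>j<n. V $$ (i, j) * f t $ j)" if "t \<in> space \<mu>" for t
    using f[OF that] V i by (simp add: scalar_prod_def atLeast0LessThan)
  have "integrable \<mu> (\<lambda>t. \<Sum>j<n. V $$ (i, j) * f t $ j)"
    using int by (intro Bochner_Integration.integrable_sum integrable_mult_right) auto
  then show "integrable \<mu> (\<lambda>t. (V *\<^sub>v f t) $ i)"
    by (subst Bochner_Integration.integrable_cong[OF refl vf])
  have "(V *\<^sub>v E) $ i = (\<Sum>j<n. V $$ (i, j) * (LINT t|\<mu>. f t $ j))"
    using V E i eq by (simp add: scalar_prod_def atLeast0LessThan)
  also have "\<dots> = (LINT t|\<mu>. (\<Sum>j<n. V $$ (i, j) * f t $ j))"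
    using int by (subst Bochner_Integration.integral_sum) auto
  also have "\<dots> = (LINT t|\<mu>. (V *\<^sub>v f t) $ i)"
    using vf by (intro Bochner_Integration.integral_cong) auto
  finally show "(V *\<^sub>v E) $ i = (LINT t|\<mu>. (V *\<^sub>v f t) $ i)" .
qed

text \<open>The triangle inequality for integrals. It is proved by duality,
  \<open>\<parallel>E\<parallel>\<^sup>2 = \<integral> Re \<langle>E, f t\<rangle> \<le> \<parallel>E\<parallel> \<integral> h\<close>, so that the measurability of \<open>t \<mapsto> \<parallel>f t\<parallel>\<close> is never at issue.\<close>

lemma energy_norm_integral_le:
  assumes A: "A \<in> carrier_mat n n" "hermitian_pos_def A" and E: "E \<in> carrier_vec n"
    and f: "\<And>t. t \<in> space \<mu> \<Longrightarrow> f t \<in> carrier_vec n"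
    and int: "\<And>j. j < n \<Longrightarrow> integrable \<mu> (\<lambda>t. f t $ j)"
    and eq: "\<And>j. j < n \<Longrightarrow> E $ j = (LINT t|\<mu>. f t $ j)"
    and h: "integrable \<mu> h" and le: "\<And>t. t \<in> space \<mu> \<Longrightarrow> energy_norm A (f t) \<le> h t"
  shows "energy_norm A E \<le> (LINT t|\<mu>. h t)"
proof -
  interpret hpd_form n A using A by unfold_locales
  let ?a = "\<lambda>j. cnj ((A *\<^sub>v E) $ j)"
  have form: "hform A E v = (\<Sum>j<n. ?a j * v $ j)" if "v \<in> carrier_vec n" for v
    using that sprod_mult_mat_vec_adjoint[OF A(1) E that] G_adjoint A(1) E
    by (simp add: hform_def scalar_prod_def[of "conjugate _" v] atLeast0LessThan
        del: index_mult_mat_vec)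
  have norm: "energy_norm A v = sqrt (Re (hform A v v))" for v
    by (simp add: energy_norm_def hform_def)
  have nn: "0 \<le> energy_norm A v" if "v \<in> carrier_vec n" for v
    using hform_self_nonneg[OF that] by (simp add: norm)
  have int': "integrable \<mu> (\<lambda>t. \<Sum>j<n. ?a j * f t $ j)"
    using int by (intro Bochner_Integration.integrable_sum integrable_mult_right) auto
  have "hform A E E = (\<Sum>j<n. ?a j * (LINT t|\<mu>. f t $ j))"
    using form[OF E] eq by simp
  also have "\<dots> = (LINT t|\<mu>. (\<Sum>j<n. ?a j * f t $ j))"
    using int by (subst Bochner_Integration.integral_sum) auto
  finally have "Re (hform A E E) = (LINT t|\<mu>. Re (\<Sum>j<n. ?a j * f t $ j))"
    using integral_Re[OF int'] by simp
  also have "\<dots> \<le> (LINT t|\<mu>. energy_norm A E * h t)"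
  proof (rule integral_mono)
    show "integrable \<mu> (\<lambda>t. Re (\<Sum>j<n. ?a j * f t $ j))" using int' by (rule integrable_Re)
    show "integrable \<mu> (\<lambda>t. energy_norm A E * h t)" using h by (rule integrable_mult_right)
    fix t assume t: "t \<in> space \<mu>"
    have "Re (\<Sum>j<n. ?a j * f t $ j) \<le> energy_norm A E * energy_norm A (f t)"
      using hform_Cauchy_Schwarz[OF E f[OF t]] form[OF f[OF t]] by (simp add: norm)
    also have "\<dots> \<le> energy_norm A E * h t"
      using le[OF t] nn[OF E] by (rule mult_left_mono)
    finally show "Re (\<Sum>j<n. ?a j * f t $ j) \<le> energy_norm A E * h t" .
  qed
  finally have "(energy_norm A E)\<^sup>2 \<le> energy_norm A E * (LINT t|\<mu>. h t)"
    using hform_self_nonneg[OF E] by (simp add: norm)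
  moreover have "0 \<le> (LINT t|\<mu>. h t)"
    using nn[OF f] le by (intro Bochner_Integration.integral_nonneg) (meson order_trans)
  ultimately show ?thesis
    using nn[OF E] by (cases "energy_norm A E = 0") (auto simp: power2_eq_square)
qed

section \<open>Congruence, shifts and Galerkin optimality\<close>

lemma hpd_one: "hermitian_pos_def (1\<^sub>m n)"
proof -
  have "mat_adjoint (1\<^sub>m n) = (1\<^sub>m n :: complex mat)"
    by (intro eq_matI) (auto simp: index_mat_adjoint)
  moreover have "0 < Re (conjugate v \<bullet> v)" if "v \<in> carrier_vec n" "v \<noteq> 0\<^sub>v n" for v :: "complex vec"
  proof -
    have "conjugate v \<bullet> v = v \<bullet>c v"
      using that(1) by (simp add: conjugate_vec_sprod_comm)
    then show ?thesis
      using conjugate_square_greater_0_vec[OF that(1)] that(2) by (simp add: less_complex_def)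
  qed
  ultimately show ?thesis by (simp add: hermitian_pos_def_def)
qed

lemma hform_one_self:
  "v \<in> carrier_vec n \<Longrightarrow> hform (1\<^sub>m n) v v = complex_of_real ((euclidean_norm v)\<^sup>2)"
  by (simp add: hform_def euclidean_norm_def scalar_prod_def sum_nonneg atLeast0LessThan
      mult.commute[of "cnj _"] complex_norm_square[symmetric])

lemma hform_shift:
  assumes "A \<in> carrier_mat n n" "u \<in> carrier_vec n" "v \<in> carrier_vec n"
  shows "hform (A + complex_of_real t \<cdot>\<^sub>m 1\<^sub>m n) u v
    = hform A u v + complex_of_real t * hform (1\<^sub>m n) u v"
  using assms unfolding hform_def
  by (simp add: shift_mult_mat_vec scalar_prod_add_distrib[of _ n])

lemma hpd_shift:
  assumes A: "A \<in> carrier_mat n n" "hermitian_pos_def A" and t: "0 \<le> t"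
  shows "hermitian_pos_def (A + complex_of_real t \<cdot>\<^sub>m 1\<^sub>m n)"
proof -
  interpret hpd_form n A using A by unfold_locales
  interpret one: hpd_form n "1\<^sub>m n" using hpd_one by unfold_locales auto
  have "mat_adjoint (A + complex_of_real t \<cdot>\<^sub>m 1\<^sub>m n) = A + complex_of_real t \<cdot>\<^sub>m 1\<^sub>m n"
  proof (intro eq_matI)
    fix i j assume ij: "i < dim_row (A + complex_of_real t \<cdot>\<^sub>m 1\<^sub>m n)"
      "j < dim_col (A + complex_of_real t \<cdot>\<^sub>m 1\<^sub>m n)"
    have "cnj (A $$ (j, i)) = A $$ (i, j)"
      using ij A(1) index_mat_adjoint[of i A j] G_adjoint by simp
    then show "mat_adjoint (A + complex_of_real t \<cdot>\<^sub>m 1\<^sub>m n) $$ (i, j)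
        = (A + complex_of_real t \<cdot>\<^sub>m 1\<^sub>m n) $$ (i, j)"
      using ij A(1) by (simp add: index_mat_adjoint)
  qed (use A in auto)
  moreover have "0 < Re (hform (A + complex_of_real t \<cdot>\<^sub>m 1\<^sub>m n) v v)"
    if v: "v \<in> carrier_vec n" "v \<noteq> 0\<^sub>v n" for v
    using hform_shift[OF A(1) v(1) v(1)] hform_self_pos[OF v] one.hform_self_nonneg[OF v(1)] t
    by (simp add: add_pos_nonneg)
  ultimately show ?thesis
    using A(1) by (simp add: hermitian_pos_def_def hform_def)
qed

lemma hform_congruence:
  assumes "M \<in> carrier_mat n n" "V \<in> carrier_mat n k" "u \<in> carrier_vec k" "v \<in> carrier_vec k"
  shows "hform (mat_adjoint V * M * V) u v = hform M (V *\<^sub>v u) (V *\<^sub>v v)"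
proof -
  have V': "mat_adjoint V \<in> carrier_mat k n" using assms by simp
  have "(mat_adjoint V * M * V) *\<^sub>v v = mat_adjoint V *\<^sub>v (M *\<^sub>v (V *\<^sub>v v))"
    using assms V' mult_carrier_mat[OF V' assms(1)]
    by (simp add: assoc_mult_mat_vec[of _ k n _ k] assoc_mult_mat_vec[of _ k n _ n])
  moreover have "conjugate u \<bullet> (mat_adjoint V *\<^sub>v (M *\<^sub>v (V *\<^sub>v v)))
      = conjugate (V *\<^sub>v u) \<bullet> (M *\<^sub>v (V *\<^sub>v v))"
    using sprod_mult_mat_vec_adjoint[OF V', of u "M *\<^sub>v (V *\<^sub>v v)"] assms by simp
  ultimately show ?thesis by (simp add: hform_def)
qed

lemma hpd_congruence:
  assumes M: "M \<in> carrier_mat n n" "hermitian_pos_def M" and V: "V \<in> carrier_mat n k"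
    and inj: "\<And>v. v \<in> carrier_vec k \<Longrightarrow> V *\<^sub>v v = 0\<^sub>v n \<Longrightarrow> v = 0\<^sub>v k"
  shows "hermitian_pos_def (mat_adjoint V * M * V)"
proof -
  interpret hpd_form n M using M by unfold_locales
  have V': "mat_adjoint V \<in> carrier_mat k n" using V by simp
  have "mat_adjoint (mat_adjoint V * M * V) = mat_adjoint V * (mat_adjoint M * V)"
    using M(1) V V' mult_carrier_mat[OF V' M(1)]
    by (simp add: mat_adjoint_mult[of _ k n _ k] mat_adjoint_mult[of _ k n _ n])
  then have "mat_adjoint (mat_adjoint V * M * V) = mat_adjoint V * M * V"
    using M(1) V V' G_adjoint by (simp add: assoc_mult_mat[of _ k n _ n _ k])
  moreover have "0 < Re (hform (mat_adjoint V * M * V) v v)"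
    if v: "v \<in> carrier_vec k" "v \<noteq> 0\<^sub>v k" for v
    unfolding hform_congruence[OF M(1) V v(1) v(1)]
    using inj[OF v(1)] v V by (intro hform_self_pos) auto
  ultimately show ?thesis
    using V V' by (simp add: hermitian_pos_def_def hform_def)
qed

text \<open>The hypothesis says that the error \<open>x - Vz\<close> is orthogonal to the range of \<open>V\<close> in the inner product
  of \<open>M\<close>, so Pythagoras applies to \<open>x - Vc = (x - Vz) + V(z - c)\<close>.\<close>

lemma galerkin_optimal:
  assumes M: "M \<in> carrier_mat n n" "hermitian_pos_def M" and V: "V \<in> carrier_mat n k"
    and x: "x \<in> carrier_vec n" and z: "z \<in> carrier_vec k" and c: "c \<in> carrier_vec k"
    and gal: "mat_adjoint V *\<^sub>v (M *\<^sub>v (V *\<^sub>v z)) = mat_adjoint V *\<^sub>v (M *\<^sub>v x)"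
  shows "energy_norm M (x - V *\<^sub>v z) \<le> energy_norm M (x - V *\<^sub>v c)"
proof -
  interpret hpd_form n M using M by unfold_locales
  define e d where "e = x - V *\<^sub>v z" and "d = V *\<^sub>v (z - c)"
  have e: "e \<in> carrier_vec n" and d: "d \<in> carrier_vec n"
    using x z c V by (auto simp: e_def d_def)
  have V': "mat_adjoint V \<in> carrier_mat k n" using V by simp
  have "mat_adjoint V *\<^sub>v (M *\<^sub>v e)
      = mat_adjoint V *\<^sub>v (M *\<^sub>v x) - mat_adjoint V *\<^sub>v (M *\<^sub>v (V *\<^sub>v z))"
    unfolding e_def using x z V V' M(1)
    by (simp add: mult_minus_distrib_mat_vec[of _ n n] mult_minus_distrib_mat_vec[of _ k n])
  also have "\<dots> = 0\<^sub>v k"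
    unfolding gal using V' by (intro eq_vecI) auto
  finally have "mat_adjoint V *\<^sub>v (M *\<^sub>v e) = 0\<^sub>v k" .
  then have "hform M d e = 0"
    using sprod_mult_mat_vec_adjoint[OF V', of "z - c" "M *\<^sub>v e"] z c e M(1)
    by (simp add: hform_def d_def)
  moreover have "hform M e d = 0"
    using hform_swap[OF M(1) G_adjoint e d] calculation by simp
  moreover have "x - V *\<^sub>v c = e + d"
    using x z c V by (auto simp: e_def d_def mult_minus_distrib_mat_vec[of _ n k])
  ultimately have "hform M (x - V *\<^sub>v c) (x - V *\<^sub>v c) = hform M e e + hform M d d"
    using e d by (simp add: hform_add_left[OF M(1)] hform_add_right[OF M(1)])
  then show ?thesis
    using hform_self_nonneg[OF d] unfolding energy_norm_def hform_def e_def[symmetric] by simp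
qed

lemma hpd_selfadjoint_form:
  assumes "A \<in> carrier_mat n n" "hermitian_pos_def A"
  shows "selfadjoint_form n (1\<^sub>m n) A"
  using assms hpd_one
  by unfold_locales (auto simp: hermitian_pos_def_def)

lemma lambda_min_max:
  "lambda_min A = Min (real_spectrum A)" "lambda_max A = Max (real_spectrum A)"
  by (simp_all add: lambda_min_def lambda_max_def real_spectrum_def)

lemma alpha_conv_rate:
  "alpha A m t = (if conv_rate (lambda_min A) (lambda_max A) t = 0 then 0
     else 1 / cosh (real m * ln (conv_rate (lambda_min A) (lambda_max A) t)))"
  by (simp add: alpha_def c_fun_def kappa_def conv_rate_def)

lemma alpha_nonneg: "0 \<le> alpha A m t"
  by (simp add: alpha_def)

text \<open>\<open>c(t)\<close> decreases in \<open>t\<close>, and \<open>1 / cosh (m ln c)\<close> increases in \<open>c \<in> (0, 1)\<close>.\<close>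

lemma alpha_antimono:
  assumes "0 < lambda_min A" "lambda_min A \<le> lambda_max A" "0 \<le> s" "s \<le> t"
  shows "alpha A m t \<le> alpha A m s"
proof (cases "lambda_min A = lambda_max A")
  case True
  then show ?thesis using assms by (simp add: alpha_conv_rate)
next
  case False
  then have less: "lambda_min A < lambda_max A" using assms by simp
  note s = conv_rate_bounds[OF assms(1) less assms(3)]
  have t: "0 < conv_rate (lambda_min A) (lambda_max A) t"
    using conv_rate_bounds(1)[OF assms(1) less] assms(3,4) by simp
  show ?thesis
    using s t cosh_ln_antimono[OF t conv_rate_antimono[OF assms] s(2), of m]
    by (simp add: alpha_conv_rate frac_le)
qed

section \<open>Krylov spaces and polynomial residuals\<close>

lemma in_cspan_cols_iff:
  assumes "V \<in> carrier_mat n k"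
  shows "w \<in> cspan n (set (cols V)) \<longleftrightarrow> (\<exists>x\<in>carrier_vec k. V *\<^sub>v x = w)"
proof -
  interpret vec_space "TYPE(complex)" n .
  have "cspan n (set (cols V)) = col_space V"
    by (simp add: cspan_def col_space_def)
  then show ?thesis
    using col_space_eq[OF assms] assms by auto
qed

lemma lin_indpt_cols_inj:
  assumes V: "V \<in> carrier_mat n k" "lin_indpt_cols V" and v: "v \<in> carrier_vec k" "V *\<^sub>v v = 0\<^sub>v n"
  shows "v = 0\<^sub>v k"
proof (rule ccontr)
  assume "v \<noteq> 0\<^sub>v k"
  interpret vec_space "TYPE(complex)" n .
  have "lin_dep (set (cols V))"
    using lin_depI[OF V(1) v(1) \<open>v \<noteq> 0\<^sub>v k\<close> v(2)] V(2) by (simp add: lin_indpt_cols_def)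
  then show False using V by (simp add: lin_indpt_cols_def)
qed

lemma vsum_in_cspan:
  assumes "finite S" "\<And>j. j \<in> S \<Longrightarrow> h j \<in> carrier_vec n" "\<And>j. j \<in> S \<Longrightarrow> h j \<in> X"
    and X: "X \<subseteq> carrier_vec n"
  shows "vsum n (\<lambda>j. c j \<cdot>\<^sub>v h j) S \<in> cspan n X"
proof -
  interpret vec_space "TYPE(complex)" n .
  show ?thesis
    using assms(1-3)
  proof (induction S rule: finite_induct)
    case empty
    have "vsum n (\<lambda>j. c j \<cdot>\<^sub>v h j) {} = 0\<^sub>v n" by (simp add: vsum_def zero_vec_def)
    moreover have "0\<^sub>v n \<in> span X"
      by (rule in_spanI[of _ "\<lambda>_. 0" "{}"]) (simp_all add: lincomb_def)
    ultimately show ?case by (simp add: cspan_def)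
  next
    case (insert j S)
    have "vsum n (\<lambda>j. c j \<cdot>\<^sub>v h j) (insert j S) = c j \<cdot>\<^sub>v h j + vsum n (\<lambda>j. c j \<cdot>\<^sub>v h j) S"
      using insert.hyps insert.prems(1)[of j] by (intro eq_vecI) (auto simp: index_vsum)
    moreover have "c j \<cdot>\<^sub>v h j \<in> span X"
      using insert.prems(2)[of j] by (intro smult_in_span[OF X] subsetD[OF in_own_span[OF X]]) simp
    moreover have "vsum n (\<lambda>j. c j \<cdot>\<^sub>v h j) S \<in> span X"
      using insert.IH insert.prems by (simp add: cspan_def)
    ultimately show ?case
      using span_add1[OF X] by (simp add: cspan_def)
  qed
qed

text \<open>The witness is \<open>w = r(A) b\<close>. If \<open>b\<close> splits into the eigenvectors \<open>g e\<close>, the residual is the sum of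
  \<open>(1 / (e + t) - r(e)) g e\<close>; its squared norm is computed by Parseval's identity and compared term
  by term with that of \<open>b\<close>.\<close>

lemma krylov_polynomial_residual:
  assumes A: "A \<in> carrier_mat n n" "hermitian_pos_def A" and b: "b \<in> carrier_vec n"
    and t: "0 \<le> t" and deg: "degree r < m"
    and bound: "\<And>e. e \<in> real_spectrum A \<Longrightarrow> \<bar>1 - (e + t) * poly r e\<bar> \<le> \<alpha>"
    and l: "0 < l" "\<And>e. e \<in> real_spectrum A \<Longrightarrow> l \<le> e"
  defines "L \<equiv> A + complex_of_real t \<cdot>\<^sub>m 1\<^sub>m n"
  shows "\<exists>w\<in>krylov_space A b m.
    (energy_norm L (mat_inv L *\<^sub>v b - w))\<^sup>2 \<le> \<alpha>\<^sup>2 * (euclidean_norm b)\<^sup>2 / (l + t)"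
proof -
  interpret selfadjoint_form n "1\<^sub>m n" A using A by (rule hpd_selfadjoint_form)
  obtain g where g: "eigen_split g" and b_eq: "b = vsum n g spec"
    using eigen_split_exists[OF b] by auto
  have gc: "\<And>e. e \<in> spec \<Longrightarrow> g e \<in> carrier_vec n"
    and gA: "\<And>e. e \<in> spec \<Longrightarrow> A *\<^sub>v g e = complex_of_real e \<cdot>\<^sub>v g e"
    using g by (auto simp: eigen_split_def)
  have nz: "\<And>e. e \<in> spec \<Longrightarrow> 0 < e + t" using l t by fastforce
  have pow: "A ^\<^sub>m j \<in> carrier_mat n n" for j using A(1) by simp
  have Apow: "(A ^\<^sub>m j) *\<^sub>v g e = complex_of_real (e ^ j) \<cdot>\<^sub>v g e" if e: "e \<in> spec" for j e
  proof (induction j)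
    case 0
    then show ?case using gc[OF e] A(1) by auto
  next
    case (Suc j)
    have "(A ^\<^sub>m Suc j) *\<^sub>v g e = (A ^\<^sub>m j) *\<^sub>v (complex_of_real e \<cdot>\<^sub>v g e)"
      using pow[of j] A(1) gc[OF e] gA[OF e] by (simp add: assoc_mult_mat_vec[of _ n n _ n])
    also have "\<dots> = complex_of_real e \<cdot>\<^sub>v (complex_of_real (e ^ j) \<cdot>\<^sub>v g e)"
      unfolding Suc.IH[symmetric] using pow[of j] gc[OF e] by (rule mult_mat_vec)
    finally show ?case by (simp add: smult_smult_assoc)
  qed
  define w where "w = vsum n (\<lambda>j. complex_of_real (coeff r j) \<cdot>\<^sub>v ((A ^\<^sub>m j) *\<^sub>v b)) {..<m}"
  have w_in: "w \<in> krylov_space A b m"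
    unfolding w_def krylov_space_def using A(1) mult_mat_vec_carrier[OF pow b]
    by (simp, intro vsum_in_cspan) auto
  have w_eq: "w = vsum n (\<lambda>e. complex_of_real (poly r e) \<cdot>\<^sub>v g e) spec"
  proof (intro eq_vecI)
    fix i assume "i < dim_vec (vsum n (\<lambda>e. complex_of_real (poly r e) \<cdot>\<^sub>v g e) spec)"
    then have i: "i < n" by simp
    have Ab: "((A ^\<^sub>m j) *\<^sub>v b) $ i = (\<Sum>e\<in>spec. complex_of_real (e ^ j) * g e $ i)" for j
    proof -
      have "(A ^\<^sub>m j) *\<^sub>v b = vsum n (\<lambda>e. complex_of_real (e ^ j) \<cdot>\<^sub>v g e) spec"
        unfolding b_eq using gc Apow by (subst mult_mat_vec_vsum[OF pow]) (auto intro!: vsum_cong)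
      then show ?thesis using i gc by (simp add: index_vsum carrier_vecD[OF gc])
    qed
    have pr: "poly r e = (\<Sum>j<m. coeff r j * e ^ j)" for e
      unfolding poly_altdef using deg
      by (intro sum.mono_neutral_left) (auto simp: coeff_eq_0)
    have "w $ i = (\<Sum>j<m. \<Sum>e\<in>spec. complex_of_real (coeff r j * e ^ j) * g e $ i)"
      unfolding w_def using i pow[THEN carrier_matD(1)]
      by (simp add: index_vsum Ab sum_distrib_left mult.assoc del: index_mult_mat_vec)
    also have "\<dots> = (\<Sum>e\<in>spec. \<Sum>j<m. complex_of_real (coeff r j * e ^ j) * g e $ i)"
      by (rule sum.swap)
    also have "\<dots> = (\<Sum>e\<in>spec. complex_of_real (poly r e) * g e $ i)"
      by (simp add: pr sum_distrib_right)
    finally show "w $ i = vsum n (\<lambda>e. complex_of_real (poly r e) \<cdot>\<^sub>v g e) spec $ i"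
      using i by (simp add: index_vsum carrier_vecD[OF gc])
  qed (simp add: w_def)
  define a where "a e = complex_of_real (1 / (e + t) - poly r e)" for e
  have x: "mat_inv L *\<^sub>v b = vsum n (\<lambda>e. complex_of_real (1 / (e + t)) \<cdot>\<^sub>v g e) spec"
    unfolding L_def b_eq using nz by (intro resolvent_eigen_split g) fastforce
  have xw: "mat_inv L *\<^sub>v b - w = vsum n (\<lambda>e. a e \<cdot>\<^sub>v g e) spec"
    unfolding x w_eq
    by (intro eq_vecI)
       (simp_all add: index_vsum carrier_vecD[OF gc] a_def left_diff_distrib sum_subtractf)
  have Lxw: "L *\<^sub>v vsum n (\<lambda>e. a e \<cdot>\<^sub>v g e) spec
      = vsum n (\<lambda>e. (a e * complex_of_real (e + t)) \<cdot>\<^sub>v g e) spec"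
    unfolding L_def using g by (rule shift_eigen_split)
  have one: "hform (1\<^sub>m n) (g e) (g e) = complex_of_real ((euclidean_norm (g e))\<^sup>2)" if "e \<in> spec" for e
    using hform_one_self gc that by blast
  have one_form: "conjugate u \<bullet> v = hform (1\<^sub>m n) u v" if "v \<in> carrier_vec n" for u v
    using that by (simp add: hform_def)
  have norm_b: "(euclidean_norm b)\<^sup>2 = (\<Sum>e\<in>spec. (euclidean_norm (g e))\<^sup>2)"
    using hform_eigen_split_self[OF g] one hform_one_self[OF b] unfolding b_eq[symmetric]
    by (simp flip: of_real_sum of_real_power)
  have "conjugate (vsum n (\<lambda>e. a e \<cdot>\<^sub>v g e) spec) \<bullet> (L *\<^sub>v vsum n (\<lambda>e. a e \<cdot>\<^sub>v g e) spec)
      = (\<Sum>e\<in>spec. cnj (a e) * (a e * complex_of_real (e + t)) * hform (1\<^sub>m n) (g e) (g e))"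
    unfolding Lxw by (simp add: one_form hform_eigen_split[OF g])
  also have "\<dots> = (\<Sum>e\<in>spec. complex_of_real ((1 - (e + t) * poly r e)\<^sup>2 * (euclidean_norm (g e))\<^sup>2 / (e + t)))"
  proof (intro sum.cong refl)
    fix e assume e: "e \<in> spec"
    have "cnj (a e) * (a e * complex_of_real (e + t)) = complex_of_real ((e + t) * (1 / (e + t) - poly r e)\<^sup>2)"
      by (simp add: a_def power2_eq_square)
    also have "(e + t) * (1 / (e + t) - poly r e)\<^sup>2 = (1 - (e + t) * poly r e)\<^sup>2 / (e + t)"
    proof -
      have "1 / (e + t) - poly r e = (1 - (e + t) * poly r e) / (e + t)"
        using nz[OF e] by (simp add: diff_divide_distrib)
      then show ?thesis using nz[OF e] by (simp add: power_divide power2_eq_square[of "e + t"])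
    qed
    finally show "cnj (a e) * (a e * complex_of_real (e + t)) * hform (1\<^sub>m n) (g e) (g e)
      = complex_of_real ((1 - (e + t) * poly r e)\<^sup>2 * (euclidean_norm (g e))\<^sup>2 / (e + t))"
      by (simp add: one[OF e])
  qed
  finally have "Re (conjugate (mat_inv L *\<^sub>v b - w) \<bullet> (L *\<^sub>v (mat_inv L *\<^sub>v b - w)))
    = (\<Sum>e\<in>spec. (1 - (e + t) * poly r e)\<^sup>2 * (euclidean_norm (g e))\<^sup>2 / (e + t))"
    unfolding xw by (simp flip: of_real_sum)
  moreover have "0 \<le> (\<Sum>e\<in>spec. (1 - (e + t) * poly r e)\<^sup>2 * (euclidean_norm (g e))\<^sup>2 / (e + t))"
    using nz by (intro sum_nonneg) (simp add: less_imp_le)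
  ultimately have "(energy_norm L (mat_inv L *\<^sub>v b - w))\<^sup>2
    = (\<Sum>e\<in>spec. (1 - (e + t) * poly r e)\<^sup>2 * (euclidean_norm (g e))\<^sup>2 / (e + t))"
    unfolding energy_norm_def by simp
  also have "\<dots> \<le> (\<Sum>e\<in>spec. \<alpha>\<^sup>2 * (euclidean_norm (g e))\<^sup>2 / (l + t))"
  proof (intro sum_mono frac_le mult_right_mono)
    fix e assume e: "e \<in> spec"
    have "0 \<le> \<alpha>" using bound[OF e] by linarith
    then show "(1 - (e + t) * poly r e)\<^sup>2 \<le> \<alpha>\<^sup>2"
      using bound[OF e] by (metis abs_le_square_iff abs_of_nonneg)
  qed (use l t in auto)
  also have "\<dots> = \<alpha>\<^sup>2 * (euclidean_norm b)\<^sup>2 / (l + t)"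
    by (simp add: norm_b sum_distrib_left sum_divide_distrib)
  finally have "(energy_norm L (mat_inv L *\<^sub>v b - w))\<^sup>2 \<le> \<alpha>\<^sup>2 * (euclidean_norm b)\<^sup>2 / (l + t)" .
  then show ?thesis using w_in by blast
qed

lemma hform_le_spectral_max:
  assumes A: "A \<in> carrier_mat n n" "hermitian_pos_def A" and v: "v \<in> carrier_vec n"
    and u: "\<And>e. e \<in> real_spectrum A \<Longrightarrow> e \<le> u"
  shows "Re (hform A v v) \<le> u * (euclidean_norm v)\<^sup>2"
proof -
  interpret selfadjoint_form n "1\<^sub>m n" A using A by (rule hpd_selfadjoint_form)
  obtain g where g: "eigen_split g" and v_eq: "v = vsum n g spec"
    using eigen_split_exists[OF v] by auto
  have gc: "\<And>e. e \<in> spec \<Longrightarrow> g e \<in> carrier_vec n"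
    using g by (auto simp: eigen_split_def)
  have one: "hform (1\<^sub>m n) (g e) (g e) = complex_of_real ((euclidean_norm (g e))\<^sup>2)" if "e \<in> spec" for e
    using hform_one_self gc that by blast
  have v1: "v = vsum n (\<lambda>e. 1 \<cdot>\<^sub>v g e) spec" by (simp add: v_eq vsum_def)
  have "hform A v v = hform (1\<^sub>m n) v (A *\<^sub>v v)"
    using A(1) v by (simp add: hform_def)
  also have "\<dots> = (\<Sum>e\<in>spec. cnj 1 * (1 * complex_of_real e) * hform (1\<^sub>m n) (g e) (g e))"
    unfolding v1 mult_eigen_split[OF g] by (rule hform_eigen_split[OF g])
  also have "\<dots> = (\<Sum>e\<in>spec. complex_of_real (e * (euclidean_norm (g e))\<^sup>2))"
    using one by (intro sum.cong) auto
  finally have "Re (hform A v v) = (\<Sum>e\<in>spec. e * (euclidean_norm (g e))\<^sup>2)"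
    by (simp flip: of_real_sum)
  also have "\<dots> \<le> (\<Sum>e\<in>spec. u * (euclidean_norm (g e))\<^sup>2)"
    using u by (intro sum_mono mult_right_mono) auto
  also have "\<dots> = u * (euclidean_norm v)\<^sup>2"
    using hform_eigen_split_self[OF g] one hform_one_self[OF v] unfolding v_eq[symmetric]
    by (simp add: sum_distrib_left flip: of_real_sum of_real_power)
  finally show ?thesis .
qed

section \<open>Error of the augmented approximant\<close>

text \<open>With \<open>G = V\<^sup>*V\<close> one has \<open>G V\<^sup>\<dagger> = V\<^sup>*\<close>, hence \<open>G (V\<^sup>\<dagger>AV) = V\<^sup>*AV\<close>, which is Hermitian. This is what makes
  the compression self-adjoint for \<open>G\<close>.\<close>

lemma compression:
  assumes A: "A \<in> carrier_mat n n" "hermitian_pos_def A" and V: "V \<in> carrier_mat n k"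
    and inj: "\<And>v. v \<in> carrier_vec k \<Longrightarrow> V *\<^sub>v v = 0\<^sub>v n \<Longrightarrow> v = 0\<^sub>v k"
  shows "pseudo_inverse V \<in> carrier_mat k n"
    and "mat_adjoint V * V * pseudo_inverse V = mat_adjoint V"
    and "mat_adjoint V * V * (pseudo_inverse V * A * V) = mat_adjoint V * A * V"
    and "selfadjoint_form k (mat_adjoint V * V) (pseudo_inverse V * A * V)"
proof -
  let ?G = "mat_adjoint V * V" and ?P = "pseudo_inverse V"
  have V': "mat_adjoint V \<in> carrier_mat k n" using V by simp
  have G: "?G \<in> carrier_mat k k" using V V' by (rule mult_carrier_mat[rotated])
  have G_hpd: "hermitian_pos_def ?G"
    using hpd_congruence[OF one_carrier_mat hpd_one V inj] V V' by simp
  interpret hpd_form k ?G using G G_hpd by unfold_locales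
  have Ginj: "v = 0\<^sub>v k" if "v \<in> carrier_vec k" "?G *\<^sub>v v = 0\<^sub>v k" for v
    using that hform_self_zeroD[OF that(1)] by (simp add: hform_def)
  note inv = mat_inv[OF G Ginj]
  show P: "?P \<in> carrier_mat k n"
    unfolding pseudo_inverse_def using inv(1) V' by (rule mult_carrier_mat)
  show GP: "?G * ?P = mat_adjoint V"
    unfolding pseudo_inverse_def using assoc_mult_mat[OF G inv(1) V'] inv(3) left_mult_one_mat[OF V'] by simp
  have PA: "?P * A \<in> carrier_mat k n" using P A(1) by (rule mult_carrier_mat)
  then have B: "?P * A * V \<in> carrier_mat k k" using V by (rule mult_carrier_mat)
  show GB: "?G * (?P * A * V) = mat_adjoint V * A * V"
    using assoc_mult_mat[OF G PA V] assoc_mult_mat[OF G P A(1)] GP by simp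
  show "selfadjoint_form k ?G (?P * A * V)"
    using B hpd_congruence[OF A V inj] unfolding GB[symmetric]
    by unfold_locales (auto simp: hermitian_pos_def_def)
qed

text \<open>Multiplication of the compressed system by \<open>V\<^sup>*V\<close> gives the Galerkin equations of the full system,
  because shifting commutes with compression.\<close>

lemma shifted_compression_galerkin:
  assumes A: "A \<in> carrier_mat n n" "hermitian_pos_def A" and V: "V \<in> carrier_mat n k"
    and inj: "\<And>v. v \<in> carrier_vec k \<Longrightarrow> V *\<^sub>v v = 0\<^sub>v n \<Longrightarrow> v = 0\<^sub>v k"
    and b: "b \<in> carrier_vec n" and z: "z \<in> carrier_vec k"
    and eq: "(pseudo_inverse V * A * V + c \<cdot>\<^sub>m 1\<^sub>m k) *\<^sub>v z = pseudo_inverse V *\<^sub>v b"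
  shows "mat_adjoint V *\<^sub>v ((A + c \<cdot>\<^sub>m 1\<^sub>m n) *\<^sub>v (V *\<^sub>v z)) = mat_adjoint V *\<^sub>v b"
proof -
  let ?G = "mat_adjoint V * V" and ?P = "pseudo_inverse V"
  let ?B = "?P * A * V"
  note comp = compression[OF A V inj]
  interpret selfadjoint_form k ?G ?B by (rule comp(4))
  have V': "mat_adjoint V \<in> carrier_mat k n" using V by simp
  have V'A: "mat_adjoint V * A \<in> carrier_mat k n" using V' A(1) by (rule mult_carrier_mat)
  have Vz: "V *\<^sub>v z \<in> carrier_vec n" using V z by simp
  have AVz: "A *\<^sub>v (V *\<^sub>v z) \<in> carrier_vec n" using A(1) Vz by simp
  have "mat_adjoint V *\<^sub>v b = ?G *\<^sub>v (?P *\<^sub>v b)"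
    using assoc_mult_mat_vec[OF G_carrier comp(1) b] comp(2) by simp
  also have "?P *\<^sub>v b = ?B *\<^sub>v z + c \<cdot>\<^sub>v z"
    unfolding eq[symmetric] by (rule shift_mult_mat_vec[OF B_carrier z])
  also have "?G *\<^sub>v (?B *\<^sub>v z + c \<cdot>\<^sub>v z) = ?G *\<^sub>v (?B *\<^sub>v z) + c \<cdot>\<^sub>v (?G *\<^sub>v z)"
    using mult_add_distrib_mat_vec[OF G_carrier mult_mat_vec_carrier[OF B_carrier z], of "c \<cdot>\<^sub>v z"]
      mult_mat_vec[OF G_carrier z] z by simp
  also have "?G *\<^sub>v (?B *\<^sub>v z) = mat_adjoint V *\<^sub>v (A *\<^sub>v (V *\<^sub>v z))"
    using assoc_mult_mat_vec[OF G_carrier B_carrier z] comp(3)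
      assoc_mult_mat_vec[OF V'A V z] assoc_mult_mat_vec[OF V' A(1) Vz] by simp
  also have "?G *\<^sub>v z = mat_adjoint V *\<^sub>v (V *\<^sub>v z)"
    using V' V z by (rule assoc_mult_mat_vec)
  also have "mat_adjoint V *\<^sub>v (A *\<^sub>v (V *\<^sub>v z)) + c \<cdot>\<^sub>v (mat_adjoint V *\<^sub>v (V *\<^sub>v z))
      = mat_adjoint V *\<^sub>v (A *\<^sub>v (V *\<^sub>v z) + c \<cdot>\<^sub>v (V *\<^sub>v z))"
    using mult_add_distrib_mat_vec[OF V' AVz, of "c \<cdot>\<^sub>v (V *\<^sub>v z)"] mult_mat_vec[OF V' Vz] Vz by simp
  also have "A *\<^sub>v (V *\<^sub>v z) + c \<cdot>\<^sub>v (V *\<^sub>v z) = (A + c \<cdot>\<^sub>m 1\<^sub>m n) *\<^sub>v (V *\<^sub>v z)"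
    by (rule shift_mult_mat_vec[OF A(1) Vz, symmetric])
  finally show ?thesis by simp
qed

text \<open>The shift adds \<open>t \<parallel>v\<parallel>\<^sup>2\<close> to the squared norm, and this is at least \<open>(t / u) \<langle>v, Av\<rangle>\<close> because
  \<open>\<langle>v, Av\<rangle> \<le> u \<parallel>v\<parallel>\<^sup>2\<close>.\<close>

lemma energy_norm_le_shifted:
  assumes A: "A \<in> carrier_mat n n" "hermitian_pos_def A" and v: "v \<in> carrier_vec n"
    and t: "0 \<le> t" and u: "0 < u" "\<And>e. e \<in> real_spectrum A \<Longrightarrow> e \<le> u"
  shows "(energy_norm A v)\<^sup>2 \<le> u / (u + t) * (energy_norm (A + complex_of_real t \<cdot>\<^sub>m 1\<^sub>m n) v)\<^sup>2"
proof -
  let ?L = "A + complex_of_real t \<cdot>\<^sub>m 1\<^sub>m n"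
  interpret hpd_form n A using A by unfold_locales
  define q where "q = Re (hform A v v)"
  have q: "0 \<le> q" "q \<le> u * (euclidean_norm v)\<^sup>2"
    using hform_self_nonneg[OF v] hform_le_spectral_max[OF A v u(2)] by (auto simp: q_def)
  have L: "Re (hform ?L v v) = q + t * (euclidean_norm v)\<^sup>2"
    using hform_shift[OF A(1) v v] hform_one_self[OF v] by (simp add: q_def)
  have "(u + t) * q \<le> u * (q + t * (euclidean_norm v)\<^sup>2)"
    using mult_left_mono[OF q(2) t] by (simp add: algebra_simps)
  then have "q \<le> u / (u + t) * (q + t * (euclidean_norm v)\<^sup>2)"
    using u(1) t by (simp add: field_simps)
  moreover have "(energy_norm A v)\<^sup>2 = q"
    using q(1) by (simp add: energy_norm_def q_def hform_def)
  moreover have "(energy_norm ?L v)\<^sup>2 = q + t * (euclidean_norm v)\<^sup>2"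
    using q(1) t L by (simp add: energy_norm_def hform_def)
  ultimately show ?thesis by simp
qed

lemma shifted_product_ge:
  assumes "0 \<le> l" "0 \<le> u" "0 \<le> (t::real)"
  shows "(sqrt (l * u) + t)\<^sup>2 \<le> (u + t) * (l + t)"
proof -
  have "2 * sqrt (l * u) \<le> l + u"
    using arith_geo_mean_sqrt[OF assms(1,2)] by simp
  from mult_right_mono[OF this assms(3)] show ?thesis
    using assms by (simp add: power2_eq_square algebra_simps real_sqrt_mult_self)
qed

text \<open>The two factors \<open>1 / sqrt (\<lambda>\<^sub>m\<^sub>a\<^sub>x + t)\<close> and \<open>1 / sqrt (\<lambda>\<^sub>m\<^sub>i\<^sub>n + t)\<close> come from the comparison of the norms and
  from the polynomial residual. They are merged into the kernel \<open>1 / (z + t)\<close> of the Stieltjes function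
  at the geometric mean \<open>z = sqrt (\<lambda>\<^sub>m\<^sub>i\<^sub>n \<lambda>\<^sub>m\<^sub>a\<^sub>x)\<close>, so that the bound can be integrated.\<close>

lemma shifted_fom_error:
  assumes A: "A \<in> carrier_mat n n" "hermitian_pos_def A" and b: "b \<in> carrier_vec n"
    and V: "V \<in> carrier_mat n k"
    and inj: "\<And>v. v \<in> carrier_vec k \<Longrightarrow> V *\<^sub>v v = 0\<^sub>v n \<Longrightarrow> v = 0\<^sub>v k"
    and krylov: "\<And>w. w \<in> krylov_space A b m \<Longrightarrow> \<exists>c\<in>carrier_vec k. V *\<^sub>v c = w"
    and m: "1 \<le> m" and t: "0 \<le> t"
    and lu: "0 < lambda_min A" "lambda_min A \<le> lambda_max A"
      "\<And>e. e \<in> real_spectrum A \<Longrightarrow> lambda_min A \<le> e \<and> e \<le> lambda_max A"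
    and z: "z \<in> carrier_vec k"
      "(pseudo_inverse V * A * V + complex_of_real t \<cdot>\<^sub>m 1\<^sub>m k) *\<^sub>v z = pseudo_inverse V *\<^sub>v b"
  shows "energy_norm A (mat_inv (A + complex_of_real t \<cdot>\<^sub>m 1\<^sub>m n) *\<^sub>v b - V *\<^sub>v z)
    \<le> euclidean_norm b * sqrt (lambda_max A) * alpha A m t / (sqrt (lambda_min A * lambda_max A) + t)"
proof -
  let ?L = "A + complex_of_real t \<cdot>\<^sub>m 1\<^sub>m n"
  let ?l = "lambda_min A" and ?u = "lambda_max A" and ?\<alpha> = "alpha A m t"
  have L: "?L \<in> carrier_mat n n" using A by simp
  interpret selfadjoint_form n "1\<^sub>m n" A using A by (rule hpd_selfadjoint_form)
  have "e + t \<noteq> 0" if "e \<in> spec" for e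
    using lu(1) lu(3)[OF that] t by linarith
  note inv = shift_inverse[OF this]
  define x where "x = mat_inv ?L *\<^sub>v b"
  have x: "x \<in> carrier_vec n" using inv(1) b by (simp add: x_def)
  have Lx: "?L *\<^sub>v x = b"
    unfolding x_def using assoc_mult_mat_vec[OF L inv(1) b] inv(3) b by simp
  define err where "err = x - V *\<^sub>v z"
  have err: "err \<in> carrier_vec n" using x V z by (simp add: err_def)
  obtain r where r: "degree r < m" "\<And>e. e \<in> {?l..?u} \<Longrightarrow> \<bar>1 - (e + t) * poly r e\<bar> \<le> ?\<alpha>"
    using residual_poly_exists[OF lu(1,2) t m] unfolding alpha_conv_rate by blast
  obtain w where w: "w \<in> krylov_space A b m"
    "(energy_norm ?L (x - w))\<^sup>2 \<le> ?\<alpha>\<^sup>2 * (euclidean_norm b)\<^sup>2 / (?l + t)"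
    using krylov_polynomial_residual[OF A b t r(1), of ?\<alpha> ?l] r(2) lu unfolding x_def by auto
  obtain c where c: "c \<in> carrier_vec k" "V *\<^sub>v c = w"
    using krylov[OF w(1)] by blast
  have gal: "mat_adjoint V *\<^sub>v (?L *\<^sub>v (V *\<^sub>v z)) = mat_adjoint V *\<^sub>v (?L *\<^sub>v x)"
    unfolding Lx by (rule shifted_compression_galerkin[OF A V inj b z])
  have "energy_norm ?L err \<le> energy_norm ?L (x - w)"
    unfolding err_def c(2)[symmetric]
    by (rule galerkin_optimal[OF L hpd_shift[OF A t] V x z(1) c(1) gal])
  moreover have "0 \<le> energy_norm ?L err"
  proof -
    interpret shifted: hpd_form n ?L using L hpd_shift[OF A t] by unfold_locales
    show ?thesis
      using shifted.hform_self_nonneg[OF err] by (simp add: energy_norm_def hform_def)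
  qed
  ultimately have "(energy_norm ?L err)\<^sup>2 \<le> ?\<alpha>\<^sup>2 * (euclidean_norm b)\<^sup>2 / (?l + t)"
    using w(2) power_mono order_trans by blast
  then have "?u / (?u + t) * (energy_norm ?L err)\<^sup>2
      \<le> ?u / (?u + t) * (?\<alpha>\<^sup>2 * (euclidean_norm b)\<^sup>2 / (?l + t))"
    using lu t by (intro mult_left_mono) auto
  also have "\<dots> = ?u * ?\<alpha>\<^sup>2 * (euclidean_norm b)\<^sup>2 / ((?u + t) * (?l + t))"
    by simp
  also have "\<dots> \<le> ?u * ?\<alpha>\<^sup>2 * (euclidean_norm b)\<^sup>2 / (sqrt (?l * ?u) + t)\<^sup>2"
    using lu t shifted_product_ge[of ?l ?u t]
    by (intro divide_left_mono mult_pos_pos zero_less_power add_pos_nonneg) auto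
  also have "\<dots> = (euclidean_norm b * sqrt ?u * ?\<alpha> / (sqrt (?l * ?u) + t))\<^sup>2"
    using lu by (simp add: power_divide power_mult_distrib)
  finally have "(energy_norm A err)\<^sup>2 \<le> (euclidean_norm b * sqrt ?u * ?\<alpha> / (sqrt (?l * ?u) + t))\<^sup>2"
    using energy_norm_le_shifted[OF A err t, of ?u] lu by fastforce
  then show ?thesis
    unfolding err_def x_def using lu(1,2) t alpha_nonneg[of A m t]
    by (elim power2_le_imp_le) (auto simp: euclidean_norm_def sum_nonneg)
qed

theorem theorem2p2:
  fixes N m k :: nat
    and A Vm U :: "complex mat"
    and b :: "complex vec"
    and t0 :: real
    and \<mu> :: "real measure"
  assumes "A \<in> carrier_mat N N" and "hermitian_pos_def A"
    and "b \<in> carrier_vec N"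
    and "t0 \<ge> 0" and "stieltjes_measure t0 \<mu>"
    and "m \<ge> 1"
    and "Vm \<in> carrier_mat N m" and "cspan N (set (cols Vm)) = krylov_space A b m"
    and "U \<in> carrier_mat N k"
    and "lin_indpt_cols (append_cols Vm U)"
  shows "energy_norm A (stieltjes_mat_fun \<mu> A *\<^sub>v b - fom_approx \<mu> A b (append_cols Vm U))
    \<le> (euclidean_norm b * sqrt (lambda_max A)
          * stieltjes_fun \<mu> (sqrt (lambda_min A * lambda_max A)))
        * alpha A m t0"
proof -
  note A = assms(1,2) and b = assms(3)
  define V where "V = append_cols Vm U"
  let ?p = "m + k"
  let ?P = "pseudo_inverse V"
  define B where "B = ?P * A * V"
  let ?RA = "\<lambda>t. mat_inv (A + complex_of_real t \<cdot>\<^sub>m 1\<^sub>m N)"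
  let ?RB = "\<lambda>t. mat_inv (B + complex_of_real t \<cdot>\<^sub>m 1\<^sub>m ?p)"
  let ?l = "lambda_min A" and ?u = "lambda_max A"
  have V: "V \<in> carrier_mat N ?p" and cols_V: "cols V = cols Vm @ cols U"
    using assms(7,9) cols_dim[of Vm] cols_dim[of U] unfolding V_def append_cols_def
    by (auto intro!: cols_mat_of_cols mat_of_cols_carrier(1)[THEN carrier_matD(1)])
  have inj: "v = 0\<^sub>v ?p" if "v \<in> carrier_vec ?p" "V *\<^sub>v v = 0\<^sub>v N" for v
    using lin_indpt_cols_inj[OF V _ that] assms(10) by (simp add: V_def)
  have krylov: "\<exists>c\<in>carrier_vec ?p. V *\<^sub>v c = w" if "w \<in> krylov_space A b m" for w
  proof -
    have "w \<in> cspan N (set (cols V))"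
    proof -
      interpret vec_space "TYPE(complex)" N .
      show ?thesis
        using that span_is_monotone[of "set (cols Vm)" "set (cols V)"]
        unfolding assms(8)[symmetric] cspan_def cols_V by auto
    qed
    then show ?thesis using in_cspan_cols_iff[OF V] by simp
  qed
  interpret SA: selfadjoint_form N "1\<^sub>m N" A using A by (rule hpd_selfadjoint_form)
  interpret SB: selfadjoint_form ?p "mat_adjoint V * V" B
    unfolding B_def by (rule compression(4)[OF A V inj])
  have posA: "0 < e" if "e \<in> real_spectrum A" for e
    using SA.spec_pos[OF _ that] A by simp
  have posB: "0 < e" if "e \<in> real_spectrum B" for e
    using SB.spec_pos[OF _ that] compression(3)[OF A V inj] hpd_congruence[OF A V inj]
    by (simp add: B_def)
  have P: "?P \<in> carrier_mat ?p N" by (rule compression(1)[OF A V inj])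
  then have Pb: "?P *\<^sub>v b \<in> carrier_vec ?p" using b by simp
  note space = space_stieltjes_measure[OF assms(5)]
  then have t_nonneg: "0 \<le> t" if "t \<in> space \<mu>" for t using that assms(4) by simp
  have nzA: "e + t \<noteq> 0" if "t \<in> space \<mu>" "e \<in> real_spectrum A" for e t
    using t_nonneg[OF that(1)] posA[OF that(2)] by simp
  have nzB: "e + t \<noteq> 0" if "t \<in> space \<mu>" "e \<in> real_spectrum B" for e t
    using t_nonneg[OF that(1)] posB[OF that(2)] by simp
  have RA: "?RA t \<in> carrier_mat N N" if "t \<in> space \<mu>" for t
    using SA.shift_inverse(1)[OF nzA[OF that]] .
  have RB: "?RB t \<in> carrier_mat ?p ?p" "(B + complex_of_real t \<cdot>\<^sub>m 1\<^sub>m ?p) * ?RB t = 1\<^sub>m ?p"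
    if "t \<in> space \<mu>" for t
    using SB.shift_inverse(1,3)[OF nzB[OF that]] by simp_all
  define z where "z t = ?RB t *\<^sub>v (?P *\<^sub>v b)" for t
  have z: "z t \<in> carrier_vec ?p" "(B + complex_of_real t \<cdot>\<^sub>m 1\<^sub>m ?p) *\<^sub>v z t = ?P *\<^sub>v b"
    if t: "t \<in> space \<mu>" for t
  proof -
    show "z t \<in> carrier_vec ?p" using RB(1)[OF t] Pb by (simp add: z_def)
    have shift: "B + complex_of_real t \<cdot>\<^sub>m 1\<^sub>m ?p \<in> carrier_mat ?p ?p"
      using SB.B_carrier by simp
    show "(B + complex_of_real t \<cdot>\<^sub>m 1\<^sub>m ?p) *\<^sub>v z t = ?P *\<^sub>v b"
      using assoc_mult_mat_vec[OF shift RB(1)[OF t] Pb] RB(2)[OF t] Pb by (simp add: z_def)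
  qed
  define err where "err t = ?RA t *\<^sub>v b - V *\<^sub>v z t" for t
  define E where "E = stieltjes_mat_fun \<mu> A *\<^sub>v b - fom_approx \<mu> A b V"
  have err: "err t \<in> carrier_vec N" if "t \<in> space \<mu>" for t
    using RA[OF that] z(1)[OF that] V b by (simp add: err_def)
  have fB: "stieltjes_mat_fun \<mu> B \<in> carrier_mat ?p ?p"
    using SB.B_carrier by (simp add: stieltjes_mat_fun_def)
  have fA: "stieltjes_mat_fun \<mu> A \<in> carrier_mat N N"
    using A by (simp add: stieltjes_mat_fun_def)
  have E: "E \<in> carrier_vec N"
    using fA fB b V Pb unfolding E_def fom_approx_def B_def[symmetric] by simp
  have intA: "integrable \<mu> (\<lambda>t. (?RA t *\<^sub>v b) $ i)"
      "(stieltjes_mat_fun \<mu> A *\<^sub>v b) $ i = (LINT t|\<mu>. (?RA t *\<^sub>v b) $ i)" if "i < N" for i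
    using stieltjes_mat_fun_mult_vec[OF A(1) b that SA.integrable_resolvent_entry[OF assms(5,4) posA] RA]
    by simp_all
  have intB: "integrable \<mu> (\<lambda>t. z t $ j)"
      "(stieltjes_mat_fun \<mu> B *\<^sub>v (?P *\<^sub>v b)) $ j = (LINT t|\<mu>. z t $ j)" if "j < ?p" for j
    unfolding z_def
    using stieltjes_mat_fun_mult_vec[OF SB.B_carrier Pb that
        SB.integrable_resolvent_entry[OF assms(5,4) posB] RB(1)]
    by simp_all
  have "stieltjes_mat_fun \<mu> B *\<^sub>v (?P *\<^sub>v b) \<in> carrier_vec ?p" using fB Pb by simp
  note intVB = integral_mult_mat_vec[OF V _ this z(1) intB]
  have err_nth: "err t $ i = (?RA t *\<^sub>v b) $ i - (V *\<^sub>v z t) $ i"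
    if "i < N" "t \<in> space \<mu>" for t i
    unfolding err_def using V that z(1)[OF that(2)] by (intro index_minus_vec(1)) simp
  have int_err: "integrable \<mu> (\<lambda>t. err t $ i)" if i: "i < N" for i
  proof -
    have "integrable \<mu> (\<lambda>t. (?RA t *\<^sub>v b) $ i - (V *\<^sub>v z t) $ i)"
      using intA(1)[OF i] intVB(1)[OF i] by (intro Bochner_Integration.integrable_diff) simp_all
    then show ?thesis
      by (subst Bochner_Integration.integrable_cong[OF refl err_nth[OF i]])
  qed
  have E_nth: "E $ i = (LINT t|\<mu>. err t $ i)" if i: "i < N" for i
  proof -
    have "E $ i = (stieltjes_mat_fun \<mu> A *\<^sub>v b) $ i
        - (V *\<^sub>v (stieltjes_mat_fun \<mu> B *\<^sub>v (?P *\<^sub>v b))) $ i"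
      unfolding E_def fom_approx_def B_def[symmetric]
      using V i by (intro index_minus_vec(1)) simp
    also have "\<dots> = (LINT t|\<mu>. (?RA t *\<^sub>v b) $ i - (V *\<^sub>v z t) $ i)"
      using intA[OF i] intVB[OF i] by (simp del: index_mult_mat_vec)
    also have "\<dots> = (LINT t|\<mu>. err t $ i)"
      using err_nth[OF i] by (intro Bochner_Integration.integral_cong) auto
    finally show ?thesis .
  qed
  show ?thesis
  proof (cases "real_spectrum A = {}")
    case True
    \<comment> \<open>an empty spectrum means \<open>N = 0\<close>, where the extreme eigenvalues are meaningless\<close>
    have zero: "v = 0\<^sub>v N" if v: "v \<in> carrier_vec N" for v :: "complex vec"
      using SA.eigen_split_exists[OF v] True by (auto simp: vsum_def zero_vec_def)
    have "energy_norm A E = 0" "euclidean_norm b = 0"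
      using zero[OF E] zero[OF b] A(1)
      by (simp_all add: energy_norm_def euclidean_norm_def)
    then show ?thesis by (simp add: E_def V_def)
  next
    case False
    have "?l \<in> real_spectrum A"
      unfolding lambda_min_max using SA.finite_spec False by (rule Min_in)
    then have lpos: "0 < ?l" by (rule posA)
    have lu: "?l \<le> e \<and> e \<le> ?u" if "e \<in> real_spectrum A" for e
      unfolding lambda_min_max using SA.finite_spec that by simp
    have "?l \<le> ?u" using False lu by fastforce
    have root: "0 < sqrt (?l * ?u)" using lpos \<open>?l \<le> ?u\<close> by simp
    define C where "C = euclidean_norm b * sqrt ?u * alpha A m t0"
    have le: "energy_norm A (err t) \<le> C * (1 / (sqrt (?l * ?u) + t))" if t: "t \<in> space \<mu>" for t
    proof -
      have "energy_norm A (err t)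
          \<le> euclidean_norm b * sqrt ?u * alpha A m t / (sqrt (?l * ?u) + t)"
        unfolding err_def using z[OF t] unfolding B_def
        by (intro shifted_fom_error[OF A b V inj krylov assms(6) t_nonneg[OF t] lpos \<open>?l \<le> ?u\<close> lu])
      also have "\<dots> \<le> euclidean_norm b * sqrt ?u * alpha A m t0 / (sqrt (?l * ?u) + t)"
        using alpha_antimono[OF lpos \<open>?l \<le> ?u\<close> assms(4), of t m] t space lpos \<open>?l \<le> ?u\<close>
          t_nonneg[OF t] root
        by (intro divide_right_mono mult_left_mono) (auto simp: euclidean_norm_def sum_nonneg)
      finally show ?thesis by (simp add: C_def)
    qed
    have int: "integrable \<mu> (\<lambda>t. C * (1 / (sqrt (?l * ?u) + t)))"
      using assms(5) root by (intro integrable_mult_right) (simp add: stieltjes_measure_def)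
    have "energy_norm A E \<le> (LINT t|\<mu>. C * (1 / (sqrt (?l * ?u) + t)))"
      by (rule energy_norm_integral_le[OF A E err int_err E_nth int le])
    also have "\<dots> = C * stieltjes_fun \<mu> (sqrt (?l * ?u))"
      unfolding stieltjes_fun_def by (rule integral_mult_right_zero)
    finally show ?thesis by (simp add: E_def V_def C_def mult_ac)
  qed
qed

end
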